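(* Let $X$ be a Banach space, let $\mathcal{U}=\{U(t,s)\}_{t\ge s\ge 0}$ be a nonuniform exponentially bounded evolution family on $X$, and let $\alpha\in\mathcal{A}(\mathcal{U})$. The infinitesimal generator $G_{\mathcal{U},\alpha}$ is invertible if and only if the admissible exponent $\alpha$ is quasi-negative.
   Context: $\mathbb{R}_+=[0,\infty)$, and $C(\mathbb{R}_+,X)$ is the space of all continuous functions $\mathbb{R}_+\to X$. An evolution family (on the half-line) is a family $\mathcal{U}=\{U(t,s)\}_{t\ge s\ge 0}$ of bounded linear operators on $X$ such that $U(t,t)=\mathrm{Id}$ for $t\ge 0$; $U(t,\tau)U(\tau,s)=U(t,s)$ for $t\ge\tau\ge s\ge 0$; and $(t,s)\mapsto U(t,s)x$ is continuous on $\{t\ge s\ge 0\}$ for every $x\in X$. A number $\alpha\in\mathbb{R}$ is an admissible exponent of $\mathcal{U}$ if there is a continuous map $M_\alpha:\mathbb{R}_+\to(0,\infty)$ with $\|U(t,s)\|\le M_\alpha(s)e^{\alpha(t-s)}$ for all $t\ge s\ge 0$. $\mathcal{A}(\mathcal{U})$ is the set of all admissible exponents, and $\mathcal{U}$ is nonuniform exponentially bounded if $\mathcal{A}(\mathcal{U})\ne\emptyset$. For $\alpha\in\mathcal{A}(\mathcal{U})$, $t\ge 0$ and $u\in C(\mathbb{R}_+,X)$, put $\varphi_{\mathcal{U},\alpha}(t,u)=\sup_{\tau\ge t}e^{-\alpha(\tau-t)}\|U(\tau,t)u(t)\|$. The admissible Banach function space is $$\mathcal{C}(\mathcal{U},\alpha)=\{u\in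 C(\mathbb{R}_+,X):\ \lim_{t\to\infty}\varphi_{\mathcal{U},\alpha}(t,u)=\|u(0)\|=0\},$$ which is a Banach space with the norm $\|u\|_{\mathcal{U},\alpha}=\sup_{t\ge 0}\varphi_{\mathcal{U},\alpha}(t,u)$. On it, the formula $(T_\alpha(t)u)(s)=U(s,s-t)u(s-t)$ if $s>t$, and $(T_\alpha(t)u)(s)=0$ if $0\le s\le t$, defines a $C_0$-semigroup $\mathcal{T}_\alpha=\{T_\alpha(t)\}_{t\ge 0}$; its infinitesimal generator is denoted $G_{\mathcal{U},\alpha}$ (i.e. $G_{\mathcal{U},\alpha}u=\lim_{t\to 0_+}\frac{T_\alpha(t)u-u}{t}$, with domain the set of $u$ for which this limit exists in $\mathcal{C}(\mathcal{U},\alpha)$). An admissible exponent $\alpha\in\mathcal{A}(\mathcal{U})$ is called quasi-negative if $\mathcal{C}(\mathcal{U},\alpha)=\mathcal{C}(\mathcal{U},-\nu)$ for some admissible exponent $-\nu\in\mathcal{A}(\mathcal{U})$ with $-\nu<0$. A linear operator $G:D(G)\subset E\to E$ on a Banach space $E$ is called invertible if it is a bijection from $D(G)$ onto $E$ with bounded inverse. *)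

theory Defs
  imports "HOL-Analysis.Analysis"
begin

definition evolution_family :: "(real \<Rightarrow> real \<Rightarrow> 'a::banach \<Rightarrow>\<^sub>L 'a) \<Rightarrow> bool" where
  "evolution_family U \<longleftrightarrow>
     (\<forall>t\<ge>0. U t t = id_blinfun) \<and>
     (\<forall>s \<tau> t. 0 \<le> s \<and> s \<le> \<tau> \<and> \<tau> \<le> t \<longrightarrow> U t \<tau> o\<^sub>L U \<tau> s = U t s) \<and>
     (\<forall>x. continuous_on {(t, s). 0 \<le> s \<and> s \<le> t} (\<lambda>(t, s). blinfun_apply (U t s) x))"

definition admissible_exponents :: "(real \<Rightarrow> real \<Rightarrow> 'a::banach \<Rightarrow>\<^sub>L 'a) \<Rightarrow> real set" where
  "admissible_exponents U =
     {\<alpha>. \<exists>M :: real \<Rightarrow> real. continuous_on {0..} M \<and> (\<forall>s\<ge>0. 0 < M s) \<and>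
          (\<forall>s t. 0 \<le> s \<and> s \<le> t \<longrightarrow> norm (U t s) \<le> M s * exp (\<alpha> * (t - s)))}"

definition nonuniform_exp_bounded :: "(real \<Rightarrow> real \<Rightarrow> 'a::banach \<Rightarrow>\<^sub>L 'a) \<Rightarrow> bool" where
  "nonuniform_exp_bounded U \<longleftrightarrow> admissible_exponents U \<noteq> {}"

text \<open>A continuous function on the half-line is represented by its unique extension to the
  real line that vanishes at negative arguments, so that equality of functions and of function
  spaces is equality on the half-line.\<close>

definition halfline_cont :: "(real \<Rightarrow> 'a::banach) set" where
  "halfline_cont = {u. continuous_on {0..} u \<and> (\<forall>t<0. u t = 0)}"

text \<open>The suprema below are suprema of reals; for an admissible exponent \<open>\<alpha>\<close> the set in
  \<open>phi\<close> is bounded, and so is the one in \<open>adm_norm\<close> for members of \<open>adm_space\<close>.\<close>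

definition phi ::
    "(real \<Rightarrow> real \<Rightarrow> 'a::banach \<Rightarrow>\<^sub>L 'a) \<Rightarrow> real \<Rightarrow> real \<Rightarrow> (real \<Rightarrow> 'a) \<Rightarrow> real" where
  "phi U \<alpha> t u = (SUP \<tau>\<in>{t..}. exp (- \<alpha> * (\<tau> - t)) * norm (blinfun_apply (U \<tau> t) (u t)))"

definition adm_space ::
    "(real \<Rightarrow> real \<Rightarrow> 'a::banach \<Rightarrow>\<^sub>L 'a) \<Rightarrow> real \<Rightarrow> (real \<Rightarrow> 'a) set" where
  "adm_space U \<alpha> = {u \<in> halfline_cont. ((\<lambda>t. phi U \<alpha> t u) \<longlongrightarrow> 0) at_top \<and> norm (u 0) = 0}"

definition adm_norm ::
    "(real \<Rightarrow> real \<Rightarrow> 'a::banach \<Rightarrow>\<^sub>L 'a) \<Rightarrow> real \<Rightarrow> (real \<Rightarrow> 'a) \<Rightarrow> real" where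
  "adm_norm U \<alpha> u = (SUP t\<in>{0..}. phi U \<alpha> t u)"

text \<open>The formula does not involve \<open>\<alpha>\<close>, which only determines the space acted on.\<close>

definition evol_semigroup ::
    "(real \<Rightarrow> real \<Rightarrow> 'a::banach \<Rightarrow>\<^sub>L 'a) \<Rightarrow> real \<Rightarrow> (real \<Rightarrow> 'a) \<Rightarrow> real \<Rightarrow> 'a" where
  "evol_semigroup U t u s = (if t < s then blinfun_apply (U s (s - t)) (u (s - t)) else 0)"

definition is_gen_value ::
    "(real \<Rightarrow> real \<Rightarrow> 'a::banach \<Rightarrow>\<^sub>L 'a) \<Rightarrow> real \<Rightarrow> (real \<Rightarrow> 'a) \<Rightarrow> (real \<Rightarrow> 'a) \<Rightarrow> bool" where
  "is_gen_value U \<alpha> u v \<longleftrightarrow> v \<in> adm_space U \<alpha> \<and>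
     ((\<lambda>t. adm_norm U \<alpha> (\<lambda>s. (evol_semigroup U t u s - u s) /\<^sub>R t - v s)) \<longlongrightarrow> 0) (at_right 0)"

definition gen_domain ::
    "(real \<Rightarrow> real \<Rightarrow> 'a::banach \<Rightarrow>\<^sub>L 'a) \<Rightarrow> real \<Rightarrow> (real \<Rightarrow> 'a) set" where
  "gen_domain U \<alpha> = {u \<in> adm_space U \<alpha>. \<exists>v. is_gen_value U \<alpha> u v}"

definition generator ::
    "(real \<Rightarrow> real \<Rightarrow> 'a::banach \<Rightarrow>\<^sub>L 'a) \<Rightarrow> real \<Rightarrow> (real \<Rightarrow> 'a) \<Rightarrow> (real \<Rightarrow> 'a)" where
  "generator U \<alpha> u = (THE v. is_gen_value U \<alpha> u v)"

text \<open>Invertibility of an operator \<open>G\<close> with domain \<open>D\<close> in the space with carrier \<open>E\<close> and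
  norm \<open>N\<close>.\<close>

definition invertible_operator ::
    "'e set \<Rightarrow> ('e \<Rightarrow> real) \<Rightarrow> 'e set \<Rightarrow> ('e \<Rightarrow> 'e) \<Rightarrow> bool" where
  "invertible_operator E N D G \<longleftrightarrow>
     bij_betw G D E \<and> (\<exists>K. \<forall>v\<in>E. N (inv_into D G v) \<le> K * N v)"

definition quasi_negative :: "(real \<Rightarrow> real \<Rightarrow> 'a::banach \<Rightarrow>\<^sub>L 'a) \<Rightarrow> real \<Rightarrow> bool" where
  "quasi_negative U \<alpha> \<longleftrightarrow> \<alpha> \<in> admissible_exponents U \<and>
     (\<exists>\<nu>. - \<nu> \<in> admissible_exponents U \<and> - \<nu> < 0 \<and> adm_space U \<alpha> = adm_space U (- \<nu>))"

end

theory Submission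
  imports Defs
begin

text \<open>
  Write \<open>|x|\<^sub>t\<close> for the supremum over \<open>\<tau> \<ge> t\<close> of \<open>exp (- \<alpha> (\<tau> - t)) \<parallel>U(\<tau>,t) x\<parallel>\<close>, the adapted norm
  \<open>anorm t x\<close>. The norm of the admissible space is \<open>sup |u(t)|\<^sub>t\<close>, and for this moving norm the
  evolution family has uniform growth, \<open>|U(t,s) x|\<^sub>t \<le> exp (\<alpha> (t - s)) |x|\<^sub>s\<close>. Both sides of the
  equivalence turn out to say that the growth can be replaced by uniform decay:
  \<open>|U(t,s) x|\<^sub>t \<le> C exp (- \<nu> (t - s)) |x|\<^sub>s\<close> for some \<open>\<nu> > 0\<close>; this condition is called
  \<open>adapted_stable\<close> below.

  The link with the generator is the variation of constants formula: if \<open>G u = v\<close>, then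
  \<open>u(t) = - \<integral>\<^sub>0\<^sup>t U(t,\<tau>) v(\<tau>) d\<tau>\<close> (\<open>gen_value_integral\<close>). So \<open>G\<close> is always injective, and invertibility
  asks whether this integral maps the admissible space boundedly into itself. Under decay it does,
  by convolution with \<open>exp (- \<nu> t)\<close>, and strong continuity of the semigroup shows that the integral
  solves \<open>G u = v\<close> (\<open>invertible_if_stable\<close>). Conversely, testing with \<open>v(\<tau>) = w(\<tau>) U(\<tau>,s) x\<close> for a
  scalar weight \<open>w\<close> gives \<open>u(t) = - (\<integral> w) U(t,s) x\<close>, so the bound \<open>K\<close> on the inverse controls
  \<open>(\<integral> w) |U(t,s) x|\<^sub>t\<close> by the supremum of \<open>w(\<tau>) |U(\<tau>,s) x|\<^sub>\<tau>\<close>. For the weight \<open>w = exp (\<nu> (\<tau> - s))\<close>,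
  suitably cut off, \<open>\<integral> w\<close> is about \<open>w / \<nu>\<close>; when \<open>1 / \<nu> = 2 K\<close> this exceeds \<open>K w\<close> by a fixed factor away
  from \<open>s\<close>, so the supremum is governed by a bounded time interval after \<open>s\<close>, and decay follows
  (\<open>stable_if_invertible\<close>).

  For quasi-negativity, the case \<open>\<alpha> < 0\<close> is immediate, so let \<open>\<alpha> \<ge> 0\<close>. Decay makes \<open>- \<nu>\<close> admissible with
  an adapted norm equivalent, uniformly in \<open>t\<close>, to the one for \<open>\<alpha>\<close>, hence with the same admissible
  space (\<open>quasi_negative_if_stable\<close>). Conversely, if the spaces for \<open>\<alpha>\<close> and \<open>- \<nu>\<close> agree but the adapted
  norms are not uniformly comparable, a gliding hump produces a function in the first space and not
  in the second: arbitrarily late there are vectors that are small for \<open>\<alpha>\<close> and of size one for \<open>- \<nu>\<close>,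
  and short pieces of their orbits are placed one after another on the half-line
  (\<open>stable_if_quasi_negative\<close>). This replaces an appeal to the open mapping theorem.
\<close>

section \<open>The adapted norms\<close>

definition adapted_norm ::
    "(real \<Rightarrow> real \<Rightarrow> 'a::banach \<Rightarrow>\<^sub>L 'a) \<Rightarrow> real \<Rightarrow> real \<Rightarrow> 'a \<Rightarrow> real" where
  "adapted_norm U \<alpha> t x = (SUP \<tau>\<in>{t..}. exp (- \<alpha> * (\<tau> - t)) * norm (U \<tau> t x))"

lemma phi_eq_adapted_norm: "phi U \<alpha> t u = adapted_norm U \<alpha> t (u t)"
  by (simp add: phi_def adapted_norm_def)

text \<open>
  The bound \<open>M\<close> is a parameter, so that the same development can be instantiated for two admissible
  exponents of one family; comparing them is what quasi-negativity is about.
\<close>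

locale bounded_evolution =
  fixes U :: "real \<Rightarrow> real \<Rightarrow> 'a::banach \<Rightarrow>\<^sub>L 'a" and \<alpha> :: real and M :: "real \<Rightarrow> real"
  assumes family: "evolution_family U"
    and bound_cont: "continuous_on {0..} M"
    and bound_pos: "0 \<le> s \<Longrightarrow> 0 < M s"
    and bound: "\<lbrakk>0 \<le> s; s \<le> t\<rbrakk> \<Longrightarrow> norm (U t s) \<le> M s * exp (\<alpha> * (t - s))"
begin

abbreviation anorm :: "real \<Rightarrow> 'a \<Rightarrow> real" where
  "anorm \<equiv> adapted_norm U \<alpha>"

lemma same_time [simp]: "0 \<le> t \<Longrightarrow> U t t x = x"
  using family by (simp add: evolution_family_def)

lemma cocycle: "\<lbrakk>0 \<le> s; s \<le> \<tau>; \<tau> \<le> t\<rbrakk> \<Longrightarrow> U t \<tau> (U \<tau> s x) = U t s x"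
proof -
  assume "0 \<le> s" "s \<le> \<tau>" "\<tau> \<le> t"
  then have "U t \<tau> o\<^sub>L U \<tau> s = U t s"
    using family unfolding evolution_family_def by blast
  then show ?thesis
    by (metis blinfun_apply_blinfun_compose)
qed

lemma strongly_continuous: "continuous_on {(t, s). 0 \<le> s \<and> s \<le> t} (\<lambda>p. U (fst p) (snd p) x)"
  using family unfolding evolution_family_def by (simp add: case_prod_unfold)

lemma apply_bound: "\<lbrakk>0 \<le> s; s \<le> t\<rbrakk> \<Longrightarrow> norm (U t s x) \<le> M s * exp (\<alpha> * (t - s)) * norm x"
  by (meson bound mult_right_mono norm_blinfun norm_ge_zero order_trans)

lemma orbit_bounded_by_bound:
  assumes "0 \<le> t" "t \<le> \<tau>"
  shows "exp (- \<alpha> * (\<tau> - t)) * norm (U \<tau> t x) \<le> M t * norm x"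
proof -
  have "exp (- \<alpha> * (\<tau> - t)) * norm (U \<tau> t x)
      \<le> exp (- \<alpha> * (\<tau> - t)) * (M t * exp (\<alpha> * (\<tau> - t)) * norm x)"
    using apply_bound[OF assms] by (intro mult_left_mono) auto
  also have "\<dots> = M t * norm x"
    by (simp add: exp_minus)
  finally show ?thesis .
qed

lemma orbit_bounded:
  "0 \<le> t \<Longrightarrow> bdd_above ((\<lambda>\<tau>. exp (- \<alpha> * (\<tau> - t)) * norm (U \<tau> t x)) ` {t..})"
  using orbit_bounded_by_bound by (intro bdd_aboveI2) auto

text \<open>
  Together with the next lemma this is the usual introduction and elimination pair for a supremum,
  with the exponential moved to the right-hand side.
\<close>

lemma orbit_le:
  assumes "0 \<le> t" "t \<le> \<tau>"
  shows "norm (U \<tau> t x) \<le> exp (\<alpha> * (\<tau> - t)) * anorm t x"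
proof -
  have "exp (- \<alpha> * (\<tau> - t)) * norm (U \<tau> t x) \<le> anorm t x"
    unfolding adapted_norm_def by (rule cSUP_upper) (use assms orbit_bounded in auto)
  then have "exp (\<alpha> * (\<tau> - t)) * (exp (- \<alpha> * (\<tau> - t)) * norm (U \<tau> t x))
      \<le> exp (\<alpha> * (\<tau> - t)) * anorm t x"
    by (rule mult_left_mono) simp
  then show ?thesis
    unfolding mult.assoc[symmetric] exp_add[symmetric] by simp
qed

lemma anorm_least:
  assumes "\<And>\<tau>. t \<le> \<tau> \<Longrightarrow> norm (U \<tau> t x) \<le> exp (\<alpha> * (\<tau> - t)) * c"
  shows "anorm t x \<le> c"
  unfolding adapted_norm_def
proof (rule cSUP_least)
  fix \<tau> assume "\<tau> \<in> {t..}"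
  with assms have "exp (- \<alpha> * (\<tau> - t)) * norm (U \<tau> t x)
      \<le> exp (- \<alpha> * (\<tau> - t)) * (exp (\<alpha> * (\<tau> - t)) * c)"
    by (intro mult_left_mono) auto
  also have "\<dots> = c"
    unfolding mult.assoc[symmetric] exp_add[symmetric] by simp
  finally show "exp (- \<alpha> * (\<tau> - t)) * norm (U \<tau> t x) \<le> c" .
qed auto

lemma norm_le_anorm: "0 \<le> t \<Longrightarrow> norm x \<le> anorm t x"
  using orbit_le[of t t x] by simp

lemma anorm_nonneg: "0 \<le> t \<Longrightarrow> 0 \<le> anorm t x"
  using norm_le_anorm[of t x] norm_ge_zero[of x] by linarith

lemma anorm_le_bound: "0 \<le> t \<Longrightarrow> anorm t x \<le> M t * norm x"
  by (rule anorm_least) (use apply_bound in \<open>auto simp: mult_ac\<close>)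

lemma anorm_zero [simp]: "0 \<le> t \<Longrightarrow> anorm t 0 = 0"
  using anorm_le_bound[of t 0] anorm_nonneg[of t 0] by simp

text \<open>
  Passing from \<open>s\<close> to \<open>t\<close> only restricts the supremum to later times, which is why the nonuniform
  constant \<open>M\<close> has disappeared.
\<close>

lemma anorm_evolution:
  assumes "0 \<le> s" "s \<le> t"
  shows "anorm t (U t s x) \<le> exp (\<alpha> * (t - s)) * anorm s x"
proof (rule anorm_least)
  fix \<tau> assume \<tau>: "t \<le> \<tau>"
  have "exp (\<alpha> * (\<tau> - t)) * (exp (\<alpha> * (t - s)) * anorm s x) = exp (\<alpha> * (\<tau> - s)) * anorm s x"
    unfolding mult.assoc[symmetric] exp_add[symmetric] by (simp add: algebra_simps)
  moreover have "norm (U \<tau> t (U t s x)) \<le> exp (\<alpha> * (\<tau> - s)) * anorm s x"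
    using orbit_le[of s \<tau> x] assms \<tau> by (simp add: cocycle)
  ultimately show "norm (U \<tau> t (U t s x)) \<le> exp (\<alpha> * (\<tau> - t)) * (exp (\<alpha> * (t - s)) * anorm s x)"
    by (simp only:)
qed

lemma anorm_triangle: "0 \<le> t \<Longrightarrow> anorm t (x + y) \<le> anorm t x + anorm t y"
proof (rule anorm_least)
  fix \<tau> assume "0 \<le> t" "t \<le> \<tau>"
  then show "norm (U \<tau> t (x + y)) \<le> exp (\<alpha> * (\<tau> - t)) * (anorm t x + anorm t y)"
    using orbit_le[of t \<tau> x] orbit_le[of t \<tau> y] norm_triangle_ineq[of "U \<tau> t x" "U \<tau> t y"]
    by (simp add: blinfun.add_right distrib_left)
qed

lemma anorm_scale_le: "0 \<le> t \<Longrightarrow> anorm t (c *\<^sub>R x) \<le> \<bar>c\<bar> * anorm t x"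
proof (rule anorm_least)
  fix \<tau> assume "0 \<le> t" "t \<le> \<tau>"
  then show "norm (U \<tau> t (c *\<^sub>R x)) \<le> exp (\<alpha> * (\<tau> - t)) * (\<bar>c\<bar> * anorm t x)"
    using mult_left_mono[OF orbit_le[of t \<tau> x], of "\<bar>c\<bar>"]
    by (simp add: blinfun.scaleR_right mult_ac)
qed

lemma anorm_scale: "0 \<le> t \<Longrightarrow> anorm t (c *\<^sub>R x) = \<bar>c\<bar> * anorm t x"
proof (cases "c = 0")
  case False
  assume t: "0 \<le> t"
  have "anorm t x \<le> \<bar>inverse c\<bar> * anorm t (c *\<^sub>R x)"
    using anorm_scale_le[OF t, of "inverse c" "c *\<^sub>R x"] False by simp
  then have "\<bar>c\<bar> * anorm t x \<le> anorm t (c *\<^sub>R x)"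
    using False by (simp add: field_simps)
  with anorm_scale_le[OF t, of c x] show ?thesis by simp
qed simp

lemma anorm_minus: "0 \<le> t \<Longrightarrow> anorm t (- x) = anorm t x"
  using anorm_scale[of t "-1" x] by simp

lemma anorm_diff: "0 \<le> t \<Longrightarrow> anorm t (x - y) \<le> anorm t x + anorm t y"
  using anorm_triangle[of t x "- y"] by (simp add: anorm_minus)

text \<open>
  Estimating each orbit separately allows any integrable majorant \<open>b\<close>. The function
  \<open>\<tau> \<mapsto> anorm t (f \<tau>)\<close> itself, a supremum of an uncountable family, is never integrated.
\<close>

lemma anorm_integral_le:
  fixes f :: "real \<Rightarrow> 'a"
  assumes "0 \<le> t" "f integrable_on S" "b integrable_on S"
    and "\<And>\<tau>. \<tau> \<in> S \<Longrightarrow> anorm t (f \<tau>) \<le> b \<tau>"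
  shows "anorm t (integral S f) \<le> integral S b"
proof (rule anorm_least)
  fix \<sigma> assume \<sigma>: "t \<le> \<sigma>"
  have 1: "U \<sigma> t (integral S f) = integral S (\<lambda>\<tau>. U \<sigma> t (f \<tau>))"
    using integral_linear[OF assms(2) blinfun.bounded_linear_right[of "U \<sigma> t"]]
    by (simp add: o_def)
  have "norm (integral S (\<lambda>\<tau>. U \<sigma> t (f \<tau>))) \<le> integral S (\<lambda>\<tau>. exp (\<alpha> * (\<sigma> - t)) * b \<tau>)"
  proof (rule integral_norm_bound_integral)
    show "(\<lambda>\<tau>. U \<sigma> t (f \<tau>)) integrable_on S"
      using integrable_linear[OF assms(2) blinfun.bounded_linear_right[of "U \<sigma> t"]]
      by (simp add: o_def)
    show "(\<lambda>\<tau>. exp (\<alpha> * (\<sigma> - t)) * b \<tau>) integrable_on S"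
      using assms(3) by (rule integrable_on_mult_right)
    fix \<tau> assume "\<tau> \<in> S"
    then have "exp (\<alpha> * (\<sigma> - t)) * anorm t (f \<tau>) \<le> exp (\<alpha> * (\<sigma> - t)) * b \<tau>"
      using assms(4) by (intro mult_left_mono) auto
    then show "norm (U \<sigma> t (f \<tau>)) \<le> exp (\<alpha> * (\<sigma> - t)) * b \<tau>"
      using orbit_le[OF assms(1) \<sigma>, of "f \<tau>"] by linarith
  qed
  then show "norm (U \<sigma> t (integral S f)) \<le> exp (\<alpha> * (\<sigma> - t)) * integral S b"
    by (simp add: 1)
qed

section \<open>Joint continuity and boundedness\<close>

lemma bound_bounded:
  assumes "0 \<le> a"
  obtains B where "0 < B" "\<And>t. 0 \<le> t \<Longrightarrow> t \<le> a \<Longrightarrow> M t \<le> B"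
proof -
  have "compact (M ` {0..a})"
    by (rule compact_continuous_image[OF continuous_on_subset[OF bound_cont]]) auto
  then obtain B where B: "\<And>y. y \<in> M ` {0..a} \<Longrightarrow> norm y \<le> B"
    by (meson bounded_iff compact_imp_bounded)
  have "M t \<le> B" if "0 \<le> t" "t \<le> a" for t
    using B[of "M t"] that by auto
  moreover from this[of 0] bound_pos[of 0] assms have "0 < B" by auto
  ultimately show ?thesis using that by blast
qed

text \<open>
  Strong continuity concerns fixed vectors; the local bound on \<open>U\<close> supplied by the continuity of \<open>M\<close>
  absorbs the variation of \<open>v\<close>.
\<close>

lemma jointly_continuous:
  assumes v: "continuous_on {0..} v"
  shows "continuous_on {(t, s). 0 \<le> s \<and> s \<le> t} (\<lambda>p. U (fst p) (snd p) (v (snd p)))"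
  unfolding continuous_on_def
proof
  fix p :: "real \<times> real"
  let ?D = "{(t, s). 0 \<le> s \<and> s \<le> (t::real)}"
  assume p: "p \<in> ?D"
  obtain t\<^sub>0 s\<^sub>0 where p_eq: "p = (t\<^sub>0, s\<^sub>0)" by force
  have cont_snd: "continuous_on ?D (\<lambda>p. v (snd p))"
    by (rule continuous_on_compose2[OF v]) (auto intro!: continuous_intros)
  have contM: "continuous_on ?D (\<lambda>p. M (snd p))"
    by (rule continuous_on_compose2[OF bound_cont]) (auto intro!: continuous_intros)
  have 1: "((\<lambda>p. v (snd p) - v s\<^sub>0) \<longlongrightarrow> 0) (at p within ?D)"
    using cont_snd p unfolding continuous_on_def by (auto simp: p_eq LIM_zero_iff)
  have 2: "((\<lambda>q. M (snd q) * exp (\<alpha> * (fst q - snd q)) * norm (v (snd q) - v s\<^sub>0)) \<longlongrightarrow>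
      M (snd p) * exp (\<alpha> * (fst p - snd p)) * norm (0::'a)) (at p within ?D)"
    using contM p unfolding continuous_on_def
    by (intro tendsto_intros 1) (auto simp: p_eq)
  have 3: "((\<lambda>q. U (fst q) (snd q) (v (snd q) - v s\<^sub>0)) \<longlongrightarrow> 0) (at p within ?D)"
  proof (rule Lim_null_comparison)
    show "\<forall>\<^sub>F q in at p within ?D. norm (U (fst q) (snd q) (v (snd q) - v s\<^sub>0))
        \<le> M (snd q) * exp (\<alpha> * (fst q - snd q)) * norm (v (snd q) - v s\<^sub>0)"
      unfolding eventually_at by (rule exI[of _ 1]) (auto intro: apply_bound)
  qed (use 2 in simp)
  have 4: "((\<lambda>q. U (fst q) (snd q) (v s\<^sub>0)) \<longlongrightarrow> U t\<^sub>0 s\<^sub>0 (v s\<^sub>0)) (at p within ?D)"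
    using strongly_continuous[of "v s\<^sub>0"] p unfolding continuous_on_def by (auto simp: p_eq)
  show "((\<lambda>q. U (fst q) (snd q) (v (snd q))) \<longlongrightarrow> U (fst p) (snd p) (v (snd p))) (at p within ?D)"
    using tendsto_add[OF 3 4] by (simp add: p_eq blinfun.diff_right)
qed

lemma orbit_integrand_continuous:
  assumes "continuous_on {0..} v"
  shows "continuous_on {0..t} (\<lambda>\<tau>. U t \<tau> (v \<tau>))"
proof -
  have "continuous_on {0..t} (\<lambda>\<tau>. (t, \<tau>))"
    by (intro continuous_intros)
  from continuous_on_compose2[OF jointly_continuous[OF assms] this] show ?thesis
    by (simp add: image_subset_iff)
qed

lemma orbit_continuous:
  assumes "0 \<le> s"
  shows "continuous_on {s..} (\<lambda>t. U t s x)"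
proof -
  have "continuous_on {s..} (\<lambda>t. (t, s))"
    by (intro continuous_intros)
  from continuous_on_compose2[OF strongly_continuous[of x] this] assms show ?thesis
    by auto
qed

lemma orbit_integrand_integrable:
  assumes "continuous_on {0..} v" "0 \<le> a" "b \<le> t"
  shows "(\<lambda>\<tau>. U t \<tau> (v \<tau>)) integrable_on {a..b}"
  by (rule integrable_continuous_real[OF continuous_on_subset[OF orbit_integrand_continuous]])
    (use assms in auto)

section \<open>The generator\<close>

lemma adm_space_iff:
  "u \<in> adm_space U \<alpha> \<longleftrightarrow> continuous_on {0..} u \<and> (\<forall>t<0. u t = 0) \<and>
     ((\<lambda>t. anorm t (u t)) \<longlongrightarrow> 0) at_top \<and> u 0 = 0"
  by (auto simp: adm_space_def halfline_cont_def phi_eq_adapted_norm)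

lemma adm_norm_upper:
  assumes "bdd_above ((\<lambda>t. anorm t (u t)) ` {0..})" "0 \<le> t"
  shows "anorm t (u t) \<le> adm_norm U \<alpha> u"
  unfolding adm_norm_def phi_eq_adapted_norm by (rule cSUP_upper) (use assms in auto)

lemma adm_norm_least:
  assumes "\<And>t. 0 \<le> t \<Longrightarrow> anorm t (u t) \<le> c"
  shows "adm_norm U \<alpha> u \<le> c" "0 \<le> adm_norm U \<alpha> u"
proof -
  show "adm_norm U \<alpha> u \<le> c"
    unfolding adm_norm_def phi_eq_adapted_norm by (rule cSUP_least) (use assms in auto)
  have "anorm 0 (u 0) \<le> adm_norm U \<alpha> u"
    by (rule adm_norm_upper) (use assms in \<open>auto intro!: bdd_aboveI2\<close>)
  then show "0 \<le> adm_norm U \<alpha> u"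
    using anorm_nonneg[of 0 "u 0"] by simp
qed

text \<open>
  Beyond some time the adapted norms are below 1; before it, \<open>M\<close> and \<open>u\<close> are bounded by compactness.
\<close>

lemma adm_space_bounded:
  assumes "u \<in> adm_space U \<alpha>"
  shows "bdd_above ((\<lambda>t. anorm t (u t)) ` {0..})"
proof -
  have u: "continuous_on {0..} u" "((\<lambda>t. anorm t (u t)) \<longlongrightarrow> 0) at_top"
    using assms by (auto simp: adm_space_iff)
  have "\<forall>\<^sub>F t in at_top. anorm t (u t) < 1"
    using u(2) by (rule order_tendstoD) simp
  then obtain R where R: "\<And>t. R \<le> t \<Longrightarrow> anorm t (u t) < 1"
    unfolding eventually_at_top_linorder by blast
  obtain B where B: "0 < B" "\<And>t. 0 \<le> t \<Longrightarrow> t \<le> max R 0 \<Longrightarrow> M t \<le> B"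
    using bound_bounded[of "max R 0"] by auto
  have "compact (u ` {0..max R 0})"
    by (rule compact_continuous_image[OF continuous_on_subset[OF u(1)]]) auto
  then obtain B' where B': "\<And>y. y \<in> u ` {0..max R 0} \<Longrightarrow> norm y \<le> B'"
    by (meson bounded_iff compact_imp_bounded)
  show ?thesis
  proof (rule bdd_aboveI2)
    fix t :: real assume "t \<in> {0..}"
    then have t: "0 \<le> t" by simp
    show "anorm t (u t) \<le> max 1 (B * B')"
    proof (cases "R \<le> t")
      case True
      then show ?thesis using R[of t] by simp
    next
      case False
      then have "M t * norm (u t) \<le> B * B'"
        using B B'[of "u t"] t by (intro mult_mono) auto
      then show ?thesis
        using anorm_le_bound[OF t, of "u t"] by simp
    qed
  qed
qed

lemma anorm_le_adm_norm:
  "\<lbrakk>u \<in> adm_space U \<alpha>; 0 \<le> t\<rbrakk> \<Longrightarrow> anorm t (u t) \<le> adm_norm U \<alpha> u"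
  by (rule adm_norm_upper[OF adm_space_bounded])

text \<open>
  This licenses reading pointwise estimates off a small value of \<open>adm_norm\<close>: the supremum of an
  unbounded set of reals would carry no information.
\<close>

lemma difference_quotient_bounded:
  assumes u: "u \<in> adm_space U \<alpha>" and v: "v \<in> adm_space U \<alpha>" and h: "0 < h"
  shows "bdd_above ((\<lambda>s. anorm s ((evol_semigroup U h u s - u s) /\<^sub>R h - v s)) ` {0..})"
proof (rule bdd_aboveI2)
  fix s :: real assume "s \<in> {0..}"
  then have s: "0 \<le> s" by simp
  let ?N = "adm_norm U \<alpha>"
  have Nu: "0 \<le> ?N u"
    using anorm_le_adm_norm[OF u, of 0] anorm_nonneg[of 0 "u 0"] by simp
  have "anorm s (evol_semigroup U h u s) \<le> exp (\<alpha> * h) * ?N u"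
  proof (cases "h < s")
    case True
    have "anorm s (U s (s - h) (u (s - h))) \<le> exp (\<alpha> * (s - (s - h))) * anorm (s - h) (u (s - h))"
      by (rule anorm_evolution) (use True h in auto)
    also have "\<dots> \<le> exp (\<alpha> * (s - (s - h))) * ?N u"
      using anorm_le_adm_norm[OF u, of "s - h"] True by (intro mult_left_mono) auto
    finally show ?thesis
      using True by (simp add: evol_semigroup_def)
  next
    case False
    then show ?thesis using Nu s by (simp add: evol_semigroup_def)
  qed
  then have "anorm s (evol_semigroup U h u s - u s) \<le> exp (\<alpha> * h) * ?N u + ?N u"
    using anorm_diff[OF s, of "evol_semigroup U h u s" "u s"] anorm_le_adm_norm[OF u s] by simp
  then have "\<bar>inverse h\<bar> * anorm s (evol_semigroup U h u s - u s)
      \<le> \<bar>inverse h\<bar> * (exp (\<alpha> * h) * ?N u + ?N u)"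
    by (rule mult_left_mono) simp
  then show "anorm s ((evol_semigroup U h u s - u s) /\<^sub>R h - v s)
      \<le> \<bar>inverse h\<bar> * (exp (\<alpha> * h) * ?N u + ?N u) + ?N v"
    using anorm_diff[OF s, of "(evol_semigroup U h u s - u s) /\<^sub>R h" "v s"]
      anorm_le_adm_norm[OF v s] by (simp add: anorm_scale[OF s] del: abs_inverse)
qed

lemma gen_value_uniform:
  assumes u: "u \<in> adm_space U \<alpha>" and v: "is_gen_value U \<alpha> u v" and "0 < \<epsilon>"
  obtains \<delta> where "0 < \<delta>" and "\<And>h s. \<lbrakk>0 < h; h < \<delta>; 0 \<le> s\<rbrakk> \<Longrightarrow>
    anorm s ((evol_semigroup U h u s - u s) /\<^sub>R h - v s) < \<epsilon>"
proof -
  let ?q = "\<lambda>h s. (evol_semigroup U h u s - u s) /\<^sub>R h - v s"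
  have vE: "v \<in> adm_space U \<alpha>" and lim: "((\<lambda>h. adm_norm U \<alpha> (?q h)) \<longlongrightarrow> 0) (at_right 0)"
    using v by (auto simp: is_gen_value_def)
  have "\<forall>\<^sub>F h in at_right 0. adm_norm U \<alpha> (?q h) < \<epsilon>"
    using lim \<open>0 < \<epsilon>\<close> by (rule order_tendstoD)
  then obtain \<delta> where \<delta>: "0 < \<delta>" "\<And>h. 0 < h \<Longrightarrow> h < \<delta> \<Longrightarrow> adm_norm U \<alpha> (?q h) < \<epsilon>"
    unfolding eventually_at_right_field by auto
  have "anorm s (?q h s) < \<epsilon>" if "0 < h" "h < \<delta>" "0 \<le> s" for h s
    using adm_norm_upper[OF difference_quotient_bounded[OF u vE that(1)] that(3)] \<delta>(2)[OF that(1,2)]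
    by linarith
  with \<delta>(1) that show ?thesis by blast
qed

lemma gen_value_unique:
  assumes u: "u \<in> adm_space U \<alpha>" and v: "is_gen_value U \<alpha> u v" and w: "is_gen_value U \<alpha> u w"
  shows "v = w"
proof
  fix s :: real
  show "v s = w s"
  proof (cases "s < 0")
    case True
    then show ?thesis
      using v w by (auto simp: is_gen_value_def adm_space_iff)
  next
    case False
    then have s: "0 \<le> s" by simp
    have "norm (v s - w s) \<le> 0 + \<epsilon>" if "0 < \<epsilon>" for \<epsilon>
    proof -
      have \<epsilon>: "0 < \<epsilon> / 2" using that by simp
      obtain \<delta>1 where \<delta>1: "0 < \<delta>1" "\<And>h s. \<lbrakk>0 < h; h < \<delta>1; 0 \<le> s\<rbrakk> \<Longrightarrow>
          anorm s ((evol_semigroup U h u s - u s) /\<^sub>R h - v s) < \<epsilon> / 2"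
        using gen_value_uniform[OF u v \<epsilon>] by blast
      obtain \<delta>2 where \<delta>2: "0 < \<delta>2" "\<And>h s. \<lbrakk>0 < h; h < \<delta>2; 0 \<le> s\<rbrakk> \<Longrightarrow>
          anorm s ((evol_semigroup U h u s - u s) /\<^sub>R h - w s) < \<epsilon> / 2"
        using gen_value_uniform[OF u w \<epsilon>] by blast
      define h where "h = min \<delta>1 \<delta>2 / 2"
      have h: "0 < h" "h < \<delta>1" "h < \<delta>2"
        using \<delta>1(1) \<delta>2(1) by (auto simp: h_def min_def)
      let ?q = "(evol_semigroup U h u s - u s) /\<^sub>R h"
      have "norm (v s - w s) \<le> norm (?q - w s) + norm (?q - v s)"
        using norm_triangle_ineq4[of "?q - w s" "?q - v s"] by simp
      also have "\<dots> \<le> anorm s (?q - w s) + anorm s (?q - v s)"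
        by (intro add_mono norm_le_anorm s)
      also have "\<dots> \<le> \<epsilon>"
        using \<delta>1(2)[OF h(1,2) s] \<delta>2(2)[OF h(1,3) s] by simp
      finally show ?thesis by simp
    qed
    then have "norm (v s - w s) \<le> 0" by (rule field_le_epsilon)
    then show ?thesis by simp
  qed
qed

lemma generator_eq:
  assumes "u \<in> adm_space U \<alpha>" "is_gen_value U \<alpha> u v"
  shows "generator U \<alpha> u = v"
  unfolding generator_def using assms gen_value_unique by blast

text \<open>
  The difference quotients of the semigroup at \<open>s\<close> describe backward increments of \<open>s \<mapsto> U t s (u s)\<close>.
  Because they converge uniformly in \<open>s\<close>, the increment after \<open>x\<close> can be read backwards from its right
  end point, and continuity of \<open>s \<mapsto> U t s (v s)\<close> turns the left derivative into a two-sided one.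
\<close>

lemma gen_value_derivative:
  assumes u: "u \<in> adm_space U \<alpha>" and v: "is_gen_value U \<alpha> u v" and x: "0 < x" "x < t"
  shows "((\<lambda>s. U t s (u s)) has_vector_derivative - U t x (v x)) (at x)"
  unfolding has_vector_derivative_def has_derivative_at_alt
proof (intro conjI allI impI)
  show "bounded_linear (\<lambda>h. h *\<^sub>R - U t x (v x))"
    by (rule bounded_linear_scaleR_left)
next
  fix e :: real assume e: "0 < e"
  \<comment> \<open>E bounds the growth from any s in [0, t] up to t, so one step size serves all s.\<close>
  define E where "E = exp (\<bar>\<alpha>\<bar> * t)"
  have E: "0 < E" by (simp add: E_def)
  have E_bound: "exp (\<alpha> * (t - s)) \<le> E" if "0 \<le> s" "s \<le> t" for s
  proof -
    have "\<alpha> * (t - s) \<le> \<bar>\<alpha>\<bar> * t"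
      using that x by (intro mult_mono) auto
    then show ?thesis by (simp add: E_def)
  qed
  have "0 < e / (2 * E)" using e E by simp
  from gen_value_uniform[OF u v this] obtain \<delta>1 where \<delta>1: "0 < \<delta>1"
    "\<And>h s. \<lbrakk>0 < h; h < \<delta>1; 0 \<le> s\<rbrakk> \<Longrightarrow>
      anorm s ((evol_semigroup U h u s - u s) /\<^sub>R h - v s) < e / (2 * E)" by blast
  have step: "norm (U t (s - h) (u (s - h)) - U t s (u s) - h *\<^sub>R U t s (v s)) \<le> e / 2 * h"
    if h: "0 < h" "h < \<delta>1" "h < s" "s \<le> t" for h s
  proof -
    have s: "0 \<le> s" using h by simp
    let ?q = "(U s (s - h) (u (s - h)) - u s) /\<^sub>R h - v s"
    have "U t (s - h) (u (s - h)) - U t s (u s) - h *\<^sub>R U t s (v s) = h *\<^sub>R U t s ?q"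
      using h by (simp add: blinfun.diff_right blinfun.scaleR_right scaleR_diff_right cocycle)
    also have "norm \<dots> = h * norm (U t s ?q)"
      using h by simp
    also have "norm (U t s ?q) \<le> exp (\<alpha> * (t - s)) * anorm s ?q"
      using s h by (intro orbit_le) auto
    also have "\<dots> \<le> E * (e / (2 * E))"
      using \<delta>1(2)[OF h(1,2) s] h s E
      by (intro mult_mono E_bound anorm_nonneg) (auto simp: evol_semigroup_def)
    also have "\<dots> = e / 2" using E by simp
    finally show ?thesis using h by (simp add: mult.commute)
  qed
  have v_cont: "continuous_on {0..} v"
    using v by (auto simp: is_gen_value_def adm_space_iff)
  have "x \<in> {0..t}" using x by simp
  from orbit_integrand_continuous[OF v_cont, of t, unfolded continuous_on_iff, rule_format, OF this, of "e / 2"]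
  obtain \<delta>2 where \<delta>2: "0 < \<delta>2"
    "\<And>y. \<lbrakk>y \<in> {0..t}; dist y x < \<delta>2\<rbrakk> \<Longrightarrow> dist (U t y (v y)) (U t x (v x)) < e / 2"
    using e by auto
  let ?d = "min (min \<delta>1 \<delta>2) (min x (t - x))"
  show "\<exists>d>0. \<forall>y. norm (y - x) < d \<longrightarrow>
      norm (U t y (u y) - U t x (u x) - (y - x) *\<^sub>R - U t x (v x)) \<le> e * norm (y - x)"
  proof (intro exI[of _ ?d] conjI allI impI)
    show "0 < ?d" using \<delta>1(1) \<delta>2(1) x by simp
    fix y assume y: "norm (y - x) < ?d"
    consider "y = x" | "y < x" | "x < y" by linarith
    then show "norm (U t y (u y) - U t x (u x) - (y - x) *\<^sub>R - U t x (v x)) \<le> e * norm (y - x)"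
    proof cases
      case 2
      then have "norm (U t y (u y) - U t x (u x) - (x - y) *\<^sub>R U t x (v x)) \<le> e / 2 * (x - y)"
        using step[of "x - y" x] y x by auto
      also have "\<dots> \<le> e * (x - y)"
        using e 2 by simp
      finally show ?thesis using 2 by (simp add: algebra_simps)
    next
      \<comment> \<open>The backward step is taken from y, so its slope is the value at y, not at x.\<close>
      case 3
      let ?r = "U t x (u x) - U t y (u y) - (y - x) *\<^sub>R U t y (v y)"
      have 1: "norm ?r \<le> e / 2 * (y - x)"
        using step[of "y - x" y] y x 3 by auto
      have "norm (U t y (v y) - U t x (v x)) \<le> e / 2"
        using \<delta>2(2)[of y] y x 3 by (auto simp: dist_norm)
      then have 2: "norm ((y - x) *\<^sub>R (U t y (v y) - U t x (v x))) \<le> (y - x) * (e / 2)"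
        using 3 by (simp add: mult_left_mono)
      have "U t y (u y) - U t x (u x) - (y - x) *\<^sub>R - U t x (v x)
          = - (?r + (y - x) *\<^sub>R (U t y (v y) - U t x (v x)))"
        by (simp add: scaleR_diff_right)
      also have "norm \<dots> \<le> e / 2 * (y - x) + (y - x) * (e / 2)"
        unfolding norm_minus_cancel by (rule norm_triangle_mono[OF 1 2])
      also have "\<dots> = e * norm (y - x)" using 3 by (simp add: field_simps)
      finally show ?thesis .
    qed simp
  qed
qed

text \<open>
  The variation of constants formula: integrate the derivative of \<open>s \<mapsto> U t s (u s)\<close>, which runs from
  \<open>U t 0 (u 0) = 0\<close> to \<open>u t\<close>.
\<close>

lemma gen_value_integral:
  assumes u: "u \<in> adm_space U \<alpha>" and v: "is_gen_value U \<alpha> u v" and t: "0 \<le> t"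
  shows "u t = - integral {0..t} (\<lambda>s. U t s (v s))"
proof -
  have "((\<lambda>s. - U t s (v s)) has_integral U t t (u t) - U t 0 (u 0)) {0..t}"
  proof (rule fundamental_theorem_of_calculus_interior[OF t])
    show "continuous_on {0..t} (\<lambda>s. U t s (u s))"
      by (rule orbit_integrand_continuous) (use u in \<open>simp add: adm_space_iff\<close>)
  qed (use gen_value_derivative[OF u v] in auto)
  then have "((\<lambda>s. - U t s (v s)) has_integral u t) {0..t}"
    using t u by (simp add: adm_space_iff)
  from has_integral_neg[OF this] have "((\<lambda>s. U t s (v s)) has_integral - u t) {0..t}"
    by simp
  then show ?thesis
    by (simp add: integral_unique)
qed

section \<open>Invertibility forces exponential decay\<close>

text \<open>
  The condition to which both sides of the equivalence reduce: uniform exponential stability of the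
  evolution family with respect to the moving norms.
\<close>

definition adapted_stable :: bool where
  "adapted_stable \<longleftrightarrow> (\<exists>\<nu>>0. \<exists>C. \<forall>s t x. 0 \<le> s \<longrightarrow> s \<le> t \<longrightarrow>
     anorm t (U t s x) \<le> C * exp (- \<nu> * (t - s)) * anorm s x)"

lemma stable_if_negative:
  assumes "\<alpha> < 0"
  shows adapted_stable
  unfolding adapted_stable_def
  by (rule exI[of _ "- \<alpha>"], intro conjI exI[of _ 1]) (use assms anorm_evolution in auto)

text \<open>
  The test function \<open>v \<tau> = w \<tau> *\<^sub>R U \<tau> s x\<close> runs along a single orbit, so \<open>U t \<tau> (v \<tau>) = w \<tau> *\<^sub>R U t s x\<close>
  and the preimage of \<open>v\<close> is a scalar multiple of that orbit; the bound on the inverse becomes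
  a scalar inequality. The compact support of \<open>w\<close> puts \<open>v\<close> in the admissible space whatever the growth
  of the orbit is.
\<close>

lemma inverse_weighted_orbit:
  fixes w :: "real \<Rightarrow> real"
  assumes inv: "bij_betw (generator U \<alpha>) (gen_domain U \<alpha>) (adm_space U \<alpha>)"
    and K: "0 \<le> K" "\<And>v. v \<in> adm_space U \<alpha> \<Longrightarrow>
      adm_norm U \<alpha> (inv_into (gen_domain U \<alpha>) (generator U \<alpha>) v) \<le> K * adm_norm U \<alpha> v"
    and s: "0 \<le> s" and w: "continuous_on UNIV w" "\<And>\<tau>. 0 \<le> w \<tau>"
    and supp: "\<And>\<tau>. \<tau> \<le> s \<Longrightarrow> w \<tau> = 0" "\<And>\<tau>. p \<le> \<tau> \<Longrightarrow> w \<tau> = 0"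
    and c: "\<And>\<tau>. s \<le> \<tau> \<Longrightarrow> w \<tau> * anorm \<tau> (U \<tau> s x) \<le> c"
    and t: "s \<le> t"
  shows "integral {0..t} w * anorm t (U t s x) \<le> K * c"
proof -
  \<comment> \<open>The maximum with s keeps the orbit defined and continuous before s, where w vanishes.\<close>
  define v where "v \<tau> = w \<tau> *\<^sub>R U (max \<tau> s) s x" for \<tau>
  have v_zero: "v \<tau> = 0" if "\<tau> \<le> s \<or> p \<le> \<tau>" for \<tau>
    using that supp by (auto simp: v_def)
  have "continuous_on UNIV (\<lambda>\<tau>. U (max \<tau> s) s x)"
    by (rule continuous_on_compose2[OF orbit_continuous[OF s, of x]])
      (auto intro!: continuous_intros)
  then have "continuous_on UNIV v"
    unfolding v_def by (rule continuous_on_scaleR[OF w(1)])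
  moreover have "((\<lambda>t. anorm t (v t)) \<longlongrightarrow> 0) at_top"
  proof (rule tendsto_eventually)
    show "\<forall>\<^sub>F t in at_top. anorm t (v t) = 0"
      using eventually_ge_at_top[of "max p 0"] by eventually_elim (auto simp: v_zero)
  qed
  ultimately have v: "v \<in> adm_space U \<alpha>"
    using s by (auto simp: adm_space_iff v_zero intro: continuous_on_subset)
  have c_nonneg: "0 \<le> c"
    using c[of s] supp(1)[of s] by simp
  have Nv: "adm_norm U \<alpha> v \<le> c"
  proof (rule adm_norm_least)
    fix \<tau> :: real assume \<tau>: "0 \<le> \<tau>"
    show "anorm \<tau> (v \<tau>) \<le> c"
    proof (cases "\<tau> \<le> s")
      case True
      then show ?thesis using c_nonneg \<tau> by (simp add: v_zero)
    next
      case False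
      then show ?thesis
        using c[of \<tau>] w(2)[of \<tau>] \<tau> by (simp add: v_def anorm_scale max_absorb1)
    qed
  qed
  define u where "u = inv_into (gen_domain U \<alpha>) (generator U \<alpha>) v"
  have "v \<in> generator U \<alpha> ` gen_domain U \<alpha>"
    using inv v by (simp add: bij_betw_def)
  then have uD: "u \<in> gen_domain U \<alpha>" and Gu: "generator U \<alpha> u = v"
    unfolding u_def by (rule inv_into_into, rule f_inv_into_f)
  then obtain v' where u: "u \<in> adm_space U \<alpha>" and v': "is_gen_value U \<alpha> u v'"
    by (auto simp: gen_domain_def)
  then have uv: "is_gen_value U \<alpha> u v"
    using Gu generator_eq by blast
  have t0: "0 \<le> t" using s t by simp
  have "integral {0..t} (\<lambda>\<tau>. U t \<tau> (v \<tau>)) = integral {0..t} (\<lambda>\<tau>. w \<tau> *\<^sub>R U t s x)"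
  proof (rule integral_cong)
    fix \<tau> assume \<tau>: "\<tau> \<in> {0..t}"
    show "U t \<tau> (v \<tau>) = w \<tau> *\<^sub>R U t s x"
    proof (cases "\<tau> \<le> s")
      case True
      then show ?thesis using supp(1)[of \<tau>] by (simp add: v_zero)
    next
      case False
      then show ?thesis
        using \<tau> s by (simp add: v_def max_absorb1 blinfun.scaleR_right cocycle)
    qed
  qed
  also have "\<dots> = integral {0..t} w *\<^sub>R U t s x"
    by (rule integral_unique, rule has_integral_scaleR_left, rule integrable_integral)
      (rule integrable_continuous_real[OF continuous_on_subset[OF w(1)]], simp)
  finally have ut: "u t = - (integral {0..t} w *\<^sub>R U t s x)"
    using gen_value_integral[OF u uv t0] by simp
  have "0 \<le> integral {0..t} w"
    by (rule integral_nonneg)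
      (use w in \<open>auto intro: integrable_continuous_real continuous_on_subset\<close>)
  then have "integral {0..t} w * anorm t (U t s x) = anorm t (u t)"
    by (simp add: ut anorm_minus anorm_scale t0)
  also have "\<dots> \<le> adm_norm U \<alpha> u"
    by (rule anorm_le_adm_norm[OF u t0])
  also have "\<dots> \<le> K * adm_norm U \<alpha> v"
    unfolding u_def by (rule K(2)[OF v])
  also have "\<dots> \<le> K * c"
    by (rule mult_left_mono[OF Nv K(1)])
  finally show ?thesis .
qed

lemma integral_exp_shift:
  fixes \<nu> :: real
  assumes "0 < \<nu>" "a \<le> b"
  shows "((\<lambda>\<tau>. exp (\<nu> * (\<tau> - s))) has_integral (exp (\<nu> * (b - s)) - exp (\<nu> * (a - s))) / \<nu>) {a..b}"
proof -
  have "((\<lambda>\<tau>. exp (\<nu> * (\<tau> - s))) has_integral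
      exp (\<nu> * (b - s)) / \<nu> - exp (\<nu> * (a - s)) / \<nu>) {a..b}"
    by (rule fundamental_theorem_of_calculus[OF assms(2)])
      (use assms(1) in \<open>auto intro!: derivative_eq_intros
        simp: has_real_derivative_iff_has_vector_derivative[symmetric]\<close>)
  then show ?thesis by (simp add: diff_divide_distrib)
qed

text \<open>
  The weight satisfies \<open>3 / 2 * K * w \<tau> \<le> integral {0..\<tau>} w\<close> at all times later than \<open>s + h\<close>. At such
  times the previous inequality gives \<open>w \<tau> * anorm \<tau> (U \<tau> s x) \<le> 2 / 3 * c\<close> with \<open>c\<close> the supremum of the
  left-hand side, so \<open>c\<close> is governed by the interval of length \<open>h\<close> after \<open>s\<close>, where the a priori growth
  bound applies. Since neither \<open>h\<close> nor \<open>\<nu>\<close> depends on \<open>s\<close>, the resulting decay is uniform.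
\<close>

lemma stable_if_invertible:
  assumes "invertible_operator (adm_space U \<alpha>) (adm_norm U \<alpha>) (gen_domain U \<alpha>) (generator U \<alpha>)"
  shows adapted_stable
proof -
  have inv: "bij_betw (generator U \<alpha>) (gen_domain U \<alpha>) (adm_space U \<alpha>)"
    using assms by (simp add: invertible_operator_def)
  obtain K0 where K0: "\<And>v. v \<in> adm_space U \<alpha> \<Longrightarrow>
      adm_norm U \<alpha> (inv_into (gen_domain U \<alpha>) (generator U \<alpha>) v) \<le> K0 * adm_norm U \<alpha> v"
    using assms by (auto simp: invertible_operator_def)
  define K where "K = max K0 1"
  have K_pos: "0 < K" by (simp add: K_def)
  have K: "adm_norm U \<alpha> (inv_into (gen_domain U \<alpha>) (generator U \<alpha>) v) \<le> K * adm_norm U \<alpha> v"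
    if "v \<in> adm_space U \<alpha>" for v
  proof -
    have "0 \<le> adm_norm U \<alpha> v"
      using anorm_le_adm_norm[OF that, of 0] anorm_nonneg[of 0 "v 0"] by simp
    then have "K0 * adm_norm U \<alpha> v \<le> K * adm_norm U \<alpha> v"
      by (intro mult_right_mono) (auto simp: K_def)
    then show ?thesis using K0[OF that] by linarith
  qed
  define \<nu> where "\<nu> = 1 / (2 * K)"
  have \<nu>: "0 < \<nu>" using K_pos by (simp add: \<nu>_def)
  \<comment> \<open>From distance h on, at most a quarter of the exponential is lost by starting the
    integral of the weight at s + 1 instead of minus infinity.\<close>
  define h where "h = 1 + ln 4 / \<nu>"
  have h1: "1 \<le> h" using \<nu> by (simp add: h_def)
  have exp_h: "4 * exp \<nu> \<le> exp (\<nu> * r)" if "h \<le> r" for r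
  proof -
    have "4 * exp \<nu> = exp (\<nu> * h)"
      using \<nu> by (simp add: h_def distrib_left exp_add)
    also have "\<dots> \<le> exp (\<nu> * r)" using that \<nu> by simp
    finally show ?thesis .
  qed
  define C where "C = exp (\<nu> * h) * exp (\<bar>\<alpha>\<bar> * h)"
  have decay: "anorm t (U t s x) \<le> C * exp (- \<nu> * (t - s)) * anorm s x"
    if s: "0 \<le> s" and t: "s \<le> t" for s t x
  proof -
    let ?f = "\<lambda>\<tau>. anorm \<tau> (U \<tau> s x)"
    have a: "0 \<le> anorm s x" by (rule anorm_nonneg[OF s])
    have growth: "?f \<tau> \<le> exp (\<bar>\<alpha>\<bar> * d) * anorm s x" if "s \<le> \<tau>" "\<tau> \<le> s + d" for \<tau> d
    proof -
      have "\<alpha> * (\<tau> - s) \<le> \<bar>\<alpha>\<bar> * d"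
        using that by (intro mult_mono) auto
      then have "exp (\<alpha> * (\<tau> - s)) * anorm s x \<le> exp (\<bar>\<alpha>\<bar> * d) * anorm s x"
        using a by (intro mult_right_mono) auto
      then show ?thesis using anorm_evolution[OF s that(1), of x] by linarith
    qed
    have weighted: "exp (\<nu> * (t - s)) * ?f t \<le> C * anorm s x"
    proof (cases "t - s \<le> h")
      case True
      have "exp (\<nu> * (t - s)) * ?f t \<le> exp (\<nu> * h) * (exp (\<bar>\<alpha>\<bar> * h) * anorm s x)"
        using True \<nu> t s by (intro mult_mono growth anorm_nonneg) auto
      then show ?thesis by (simp add: C_def mult.assoc)
    next
      case False
      define T where "T = t - s"
      have T: "h \<le> T" "0 \<le> T" using False h1 by (auto simp: T_def)
      \<comment> \<open>A ramp up to time s + 1, the exponential frozen at its value at time t = s + T, and a ramp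
        down to zero. Freezing keeps w dominated by its own integral after t as well.\<close>
      define w where "w \<tau> = max 0 (min (\<tau> - s) 1) * exp (\<nu> * min (\<tau> - s) T)
        * max 0 (min 1 (T + 1 - (\<tau> - s)))" for \<tau>
      have w_cont: "continuous_on A w" for A
        unfolding w_def by (intro continuous_intros)
      have w_nonneg: "0 \<le> w \<tau>" for \<tau> by (simp add: w_def)
      have w_le: "w \<tau> \<le> exp (\<nu> * min (\<tau> - s) T)" for \<tau>
      proof -
        have "w \<tau> \<le> 1 * exp (\<nu> * min (\<tau> - s) T) * 1"
          unfolding w_def by (intro mult_mono) auto
        then show ?thesis by simp
      qed
      have w_eq: "w \<tau> = exp (\<nu> * (\<tau> - s))" if "s + 1 \<le> \<tau>" "\<tau> \<le> s + T" for \<tau>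
        using that by (simp add: w_def)
      have w_before: "w \<tau> = 0" if "\<tau> \<le> s" for \<tau>
        using that by (simp add: w_def)
      have w_after: "w \<tau> = 0" if "s + T + 1 \<le> \<tau>" for \<tau>
        using that by (simp add: w_def)
      have w_int: "w integrable_on {a..b}" for a b
        by (rule integrable_continuous_real[OF w_cont])
      have w_integral: "3 / 2 * K * w \<tau> \<le> integral {0..\<tau>} w" if \<tau>: "s + h \<le> \<tau>" for \<tau>
      proof -
        let ?m = "min (\<tau> - s) T"
        have m: "h \<le> ?m" "1 \<le> ?m" using \<tau> T h1 by auto
        have "3 / 2 * K * w \<tau> \<le> 3 / 2 * K * exp (\<nu> * ?m)"
          using K_pos by (intro mult_left_mono w_le) auto
        also have "\<dots> \<le> 2 * K * (exp (\<nu> * ?m) - exp \<nu>)"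
        proof -
          have "K * (4 * exp \<nu>) \<le> K * exp (\<nu> * ?m)"
            using exp_h[OF m(1)] K_pos by (intro mult_left_mono) auto
          then show ?thesis by (simp add: algebra_simps)
        qed
        also have "\<dots> = integral {s + 1..s + ?m} w"
        proof -
          have "((\<lambda>\<sigma>. exp (\<nu> * (\<sigma> - s))) has_integral
              (exp (\<nu> * (s + ?m - s)) - exp (\<nu> * (s + 1 - s))) / \<nu>) {s + 1..s + ?m}"
            by (rule integral_exp_shift[OF \<nu>]) (use m in simp)
          then have "(w has_integral
              (exp (\<nu> * (s + ?m - s)) - exp (\<nu> * (s + 1 - s))) / \<nu>) {s + 1..s + ?m}"
            by (rule has_integral_eq[rotated]) (use w_eq in auto)
          then have "integral {s + 1..s + ?m} w
              = (exp (\<nu> * (s + ?m - s)) - exp (\<nu> * (s + 1 - s))) / \<nu>"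
            by (rule integral_unique)
          moreover have "y / \<nu> = 2 * K * y" for y
            using K_pos by (simp add: \<nu>_def)
          ultimately show ?thesis by simp
        qed
        also have "\<dots> \<le> integral {0..\<tau>} w"
          by (rule integral_subset_le) (use s w_int w_nonneg in auto)
        finally show ?thesis .
      qed
      let ?c = "SUP \<tau>\<in>{s..}. w \<tau> * ?f \<tau>"
      have bdd: "bdd_above ((\<lambda>\<tau>. w \<tau> * ?f \<tau>) ` {s..})"
      proof (rule bdd_aboveI2)
        fix \<tau> assume "\<tau> \<in> {s..}"
        then have \<tau>: "s \<le> \<tau>" by simp
        show "w \<tau> * ?f \<tau> \<le> exp (\<nu> * T) * (exp (\<bar>\<alpha>\<bar> * (T + 1)) * anorm s x)"
        proof (cases "s + T + 1 \<le> \<tau>")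
          case True
          then show ?thesis using a by (simp add: w_after)
        next
          case False
          have "exp (\<nu> * min (\<tau> - s) T) \<le> exp (\<nu> * T)" using \<nu> by simp
          then have "w \<tau> \<le> exp (\<nu> * T)" using w_le[of \<tau>] by linarith
          then show ?thesis
            using False \<tau> s by (intro mult_mono growth anorm_nonneg) auto
        qed
      qed
      have upper: "w \<tau> * ?f \<tau> \<le> ?c" if "s \<le> \<tau>" for \<tau>
        by (rule cSUP_upper[OF _ bdd]) (use that in simp)
      have "?c \<le> max (2 / 3 * ?c) (C * anorm s x)"
      proof (rule cSUP_least)
        fix \<tau> assume "\<tau> \<in> {s..}"
        then have \<tau>: "s \<le> \<tau>" by simp
        then have f: "0 \<le> ?f \<tau>" using s by (intro anorm_nonneg) auto
        show "w \<tau> * ?f \<tau> \<le> max (2 / 3 * ?c) (C * anorm s x)"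
        proof (cases "s + h \<le> \<tau>")
          case True
          have "3 / 2 * K * w \<tau> * ?f \<tau> \<le> integral {0..\<tau>} w * ?f \<tau>"
            by (rule mult_right_mono[OF w_integral[OF True] f])
          also have "\<dots> \<le> K * ?c"
            by (rule inverse_weighted_orbit[OF inv _ K s w_cont w_nonneg w_before w_after upper \<tau>])
              (use K_pos in auto)
          finally have "K * (3 / 2 * (w \<tau> * ?f \<tau>)) \<le> K * ?c"
            by (simp add: mult_ac)
          then have "3 / 2 * (w \<tau> * ?f \<tau>) \<le> ?c"
            using K_pos by simp
          then show ?thesis by simp
        next
          case False
          have "exp (\<nu> * min (\<tau> - s) T) \<le> exp (\<nu> * h)" using \<nu> False by simp
          then have "w \<tau> \<le> exp (\<nu> * h)" using w_le[of \<tau>] by linarith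
          then have "w \<tau> * ?f \<tau> \<le> exp (\<nu> * h) * (exp (\<bar>\<alpha>\<bar> * h) * anorm s x)"
            using False \<tau> f by (intro mult_mono growth) auto
          then show ?thesis by (simp add: C_def mult.assoc)
        qed
      qed simp
      moreover have "0 \<le> C * anorm s x" using a by (simp add: C_def)
      \<comment> \<open>If two thirds of the supremum were the larger bound, the supremum would be at most zero.\<close>
      ultimately have "?c \<le> C * anorm s x" by linarith
      moreover have "w t = exp (\<nu> * (t - s))"
        by (rule w_eq) (use T h1 in \<open>auto simp: T_def\<close>)
      ultimately show ?thesis using upper[OF t] by simp
    qed
    have "?f t = exp (- \<nu> * (t - s)) * (exp (\<nu> * (t - s)) * ?f t)"
      unfolding mult.assoc[symmetric] exp_add[symmetric] by simp
    also have "\<dots> \<le> exp (- \<nu> * (t - s)) * (C * anorm s x)"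
      by (rule mult_left_mono[OF weighted]) simp
    finally show ?thesis by (simp add: mult_ac)
  qed
  then show ?thesis
    unfolding adapted_stable_def using \<nu> by blast
qed

section \<open>From exponential decay to quasi-negativity\<close>

lemma admissible: "\<alpha> \<in> admissible_exponents U"
  unfolding admissible_exponents_def using bound_cont bound_pos bound by blast

lemma adapted_norm_antimono:
  assumes "bounded_evolution U \<beta> N" "\<beta> \<le> \<alpha>" "0 \<le> t"
  shows "anorm t x \<le> adapted_norm U \<beta> t x"
proof -
  interpret b: bounded_evolution U \<beta> N by fact
  show ?thesis
  proof (rule anorm_least)
    fix \<tau> assume \<tau>: "t \<le> \<tau>"
    have "\<beta> * (\<tau> - t) \<le> \<alpha> * (\<tau> - t)"
      using assms \<tau> by (intro mult_right_mono) auto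
    then have "exp (\<beta> * (\<tau> - t)) * b.anorm t x \<le> exp (\<alpha> * (\<tau> - t)) * b.anorm t x"
      using b.anorm_nonneg[OF assms(3)] by (intro mult_right_mono) auto
    then show "norm (U \<tau> t x) \<le> exp (\<alpha> * (\<tau> - t)) * b.anorm t x"
      using b.orbit_le[OF assms(3) \<tau>, of x] by linarith
  qed
qed

lemma quasi_negative_if_negative:
  assumes "\<alpha> < 0"
  shows "quasi_negative U \<alpha>"
  unfolding quasi_negative_def using admissible assms by (intro conjI exI[of _ "- \<alpha>"]) auto

text \<open>
  For \<open>\<alpha> \<ge> 0\<close> the two adapted norms satisfy \<open>anorm t x \<le> neg.anorm t x \<le> C * anorm t x\<close> with a constant
  that does not depend on \<open>t\<close>, so they define the same space. The left inequality uses \<open>- \<nu> \<le> \<alpha>\<close>,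
  which is why negative \<open>\<alpha>\<close> is treated apart.
\<close>

lemma quasi_negative_if_stable:
  assumes adapted_stable
  shows "quasi_negative U \<alpha>"
proof (cases "\<alpha> < 0")
  case True
  then show ?thesis by (rule quasi_negative_if_negative)
next
  case False
  obtain \<nu> C0 where \<nu>: "0 < \<nu>" and C0: "\<And>s t x. 0 \<le> s \<Longrightarrow> s \<le> t \<Longrightarrow>
      anorm t (U t s x) \<le> C0 * exp (- \<nu> * (t - s)) * anorm s x"
    using assms unfolding adapted_stable_def by blast
  define C where "C = max C0 1"
  have C_pos: "0 < C" by (simp add: C_def)
  have decay: "norm (U t s x) \<le> exp (- \<nu> * (t - s)) * (C * anorm s x)" if "0 \<le> s" "s \<le> t" for s t x
  proof -
    have "norm (U t s x) \<le> anorm t (U t s x)"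
      using that by (intro norm_le_anorm) auto
    also have "\<dots> \<le> C0 * (exp (- \<nu> * (t - s)) * anorm s x)"
      using C0[OF that, of x] by (simp add: mult.assoc)
    also have "\<dots> \<le> C * (exp (- \<nu> * (t - s)) * anorm s x)"
      using anorm_nonneg[OF that(1), of x] by (intro mult_right_mono) (auto simp: C_def)
    finally show ?thesis by (simp add: mult_ac)
  qed
  interpret neg: bounded_evolution U "- \<nu>" "\<lambda>s. C * M s"
  proof
    show "continuous_on {0..} (\<lambda>s. C * M s)"
      by (intro continuous_intros bound_cont)
    show "norm (U t s) \<le> C * M s * exp (- \<nu> * (t - s))" if "0 \<le> s" "s \<le> t" for s t
    proof (rule norm_blinfun_bound)
      show "0 \<le> C * M s * exp (- \<nu> * (t - s))"
        using C_pos bound_pos[OF that(1)] by simp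
      fix x
      have "exp (- \<nu> * (t - s)) * (C * anorm s x) \<le> exp (- \<nu> * (t - s)) * (C * (M s * norm x))"
        using C_pos by (intro mult_left_mono anorm_le_bound that) auto
      then show "norm (U t s x) \<le> C * M s * exp (- \<nu> * (t - s)) * norm x"
        using decay[OF that, of x] by (simp add: mult_ac)
    qed
  qed (use family bound_pos C_pos in auto)
  have le: "neg.anorm t x \<le> C * anorm t x" if "0 \<le> t" for t x
    by (rule neg.anorm_least) (use decay that in auto)
  have ge: "anorm t x \<le> neg.anorm t x" if "0 \<le> t" for t x
    by (rule adapted_norm_antimono[OF neg.bounded_evolution_axioms _ that]) (use \<nu> False in simp)
  have "((\<lambda>t. anorm t (u t)) \<longlongrightarrow> 0) at_top \<longleftrightarrow> ((\<lambda>t. neg.anorm t (u t)) \<longlongrightarrow> 0) at_top" for u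
  proof
    assume "((\<lambda>t. anorm t (u t)) \<longlongrightarrow> 0) at_top"
    then have lim: "((\<lambda>t. C * anorm t (u t)) \<longlongrightarrow> 0) at_top"
      by (rule tendsto_mult_right_zero)
    show "((\<lambda>t. neg.anorm t (u t)) \<longlongrightarrow> 0) at_top"
      by (rule tendsto_sandwich[OF _ _ tendsto_const lim])
        (use eventually_ge_at_top[of "0::real"] in
          \<open>(eventually_elim, use le neg.anorm_nonneg in auto)+\<close>)
  next
    assume lim: "((\<lambda>t. neg.anorm t (u t)) \<longlongrightarrow> 0) at_top"
    show "((\<lambda>t. anorm t (u t)) \<longlongrightarrow> 0) at_top"
      by (rule tendsto_sandwich[OF _ _ tendsto_const lim])
        (use eventually_ge_at_top[of "0::real"] in
          \<open>(eventually_elim, use ge anorm_nonneg in auto)+\<close>)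
  qed
  then have "adm_space U \<alpha> = adm_space U (- \<nu>)"
    by (auto simp: adm_space_iff neg.adm_space_iff)
  then show ?thesis
    unfolding quasi_negative_def using admissible neg.admissible \<nu> by auto
qed

section \<open>From quasi-negativity to exponential decay\<close>

text \<open>
  One step of the gliding hump. Take \<open>x\<close> with \<open>exp (\<nu> (\<sigma> - t)) \<parallel>U(\<sigma>,t) x\<parallel> = 1\<close> and \<open>anorm t x\<close> tiny. The
  hump follows the orbit of \<open>x\<close>, multiplied by a tent function: it starts and ends at zero, and along
  the orbit the adapted norm for \<open>\<alpha>\<close> grows by at most a fixed factor. At its peak it still reaches
  the large value at time \<open>\<sigma>\<close>, because the peak comes no later than \<open>\<sigma>\<close>.
\<close>

lemma hump:
  assumes \<alpha>: "0 \<le> \<alpha>" and \<nu>: "0 < \<nu>" and \<epsilon>: "0 < \<epsilon>"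
    and unstable: "\<And>C. \<exists>t\<ge>R. \<exists>\<sigma>\<ge>t. \<exists>x. C * exp (- \<nu> * (\<sigma> - t)) * anorm t x < norm (U \<sigma> t x)"
    and R: "0 \<le> R"
  obtains w p q where "continuous_on UNIV w" "R \<le> p" "p + 1 \<le> q"
    "\<And>\<tau>. \<tau> \<le> p \<Longrightarrow> w \<tau> = 0" "\<And>\<tau>. q \<le> \<tau> \<Longrightarrow> w \<tau> = 0"
    "\<And>\<tau>. 0 \<le> \<tau> \<Longrightarrow> anorm \<tau> (w \<tau>) \<le> \<epsilon>"
    "\<exists>\<tau>\<ge>p. \<exists>\<sigma>\<ge>\<tau>. exp (- \<nu>) \<le> exp (\<nu> * (\<sigma> - \<tau>)) * norm (U \<sigma> \<tau> (w \<tau>))"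
proof -
  \<comment> \<open>The factor exp (2 \<alpha>) pays for growth along the hump, whose support has length at most 2;
    C > 1 forces \<sigma> to be strictly later than t.\<close>
  define C where "C = 1 + exp (2 * \<alpha>) / \<epsilon>"
  have C: "1 < C" "exp (2 * \<alpha>) \<le> \<epsilon> * C"
    using \<epsilon> by (auto simp: C_def field_simps)
  obtain t \<sigma> x0 where t: "R \<le> t" and \<sigma>: "t \<le> \<sigma>"
    and x0: "C * exp (- \<nu> * (\<sigma> - t)) * anorm t x0 < norm (U \<sigma> t x0)"
    using unstable[of C] by blast
  have t0: "0 \<le> t" using t R by simp
  define x where "x = inverse (exp (\<nu> * (\<sigma> - t)) * norm (U \<sigma> t x0)) *\<^sub>R x0"
  have "0 \<le> C * exp (- \<nu> * (\<sigma> - t)) * anorm t x0"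
    using C anorm_nonneg[OF t0, of x0] by simp
  with x0 have n0: "0 < norm (U \<sigma> t x0)" by linarith
  have peak: "exp (\<nu> * (\<sigma> - t)) * norm (U \<sigma> t x) = 1"
    using n0 by (simp add: x_def blinfun.scaleR_right field_simps)
  have small: "C * anorm t x \<le> 1"
  proof -
    have "C * anorm t x0 = exp (\<nu> * (\<sigma> - t)) * (C * exp (- \<nu> * (\<sigma> - t)) * anorm t x0)"
      by (simp add: exp_minus)
    also have "\<dots> \<le> exp (\<nu> * (\<sigma> - t)) * norm (U \<sigma> t x0)"
      using x0 by (intro mult_left_mono) auto
    finally show ?thesis
      using n0 by (simp add: x_def anorm_scale[OF t0] abs_mult field_simps)
  qed
  have a: "0 \<le> anorm t x" by (rule anorm_nonneg[OF t0])
  have "t \<noteq> \<sigma>"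
  proof
    assume "t = \<sigma>"
    then have "norm x = 1" using peak t0 by simp
    then have "1 \<le> anorm t x" using norm_le_anorm[OF t0, of x] by simp
    then have "C * 1 \<le> C * anorm t x" using C by (intro mult_left_mono) auto
    then show False using small C by linarith
  qed
  then have \<sigma>': "t < \<sigma>" using \<sigma> by simp
  \<comment> \<open>The peak t + \<delta> must come no later than \<sigma>, and within distance 1 of t.\<close>
  define \<delta> where "\<delta> = min 1 (\<sigma> - t)"
  have \<delta>: "0 < \<delta>" "\<delta> \<le> 1" "t + \<delta> \<le> \<sigma>" using \<sigma>' by (auto simp: \<delta>_def)
  define \<psi> where "\<psi> \<tau> = max 0 (1 - \<bar>\<tau> - (t + \<delta>)\<bar> / \<delta>)" for \<tau>
  define w where "w \<tau> = \<psi> \<tau> *\<^sub>R U (max \<tau> t) t x" for \<tau>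
  have \<psi>: "0 \<le> \<psi> \<tau>" "\<psi> \<tau> \<le> 1" for \<tau> using \<delta> by (auto simp: \<psi>_def)
  have \<psi>_before: "\<psi> \<tau> = 0" if "\<tau> \<le> t" for \<tau>
    using that \<delta> by (simp add: \<psi>_def field_simps abs_if)
  have \<psi>_after: "\<psi> \<tau> = 0" if "t + 2 \<le> \<tau>" for \<tau>
    using that \<delta> by (simp add: \<psi>_def field_simps abs_if)
  have "continuous_on UNIV (\<lambda>\<tau>. U (max \<tau> t) t x)"
    by (rule continuous_on_compose2[OF orbit_continuous[OF t0, of x]])
      (auto intro!: continuous_intros)
  moreover have "continuous_on UNIV \<psi>"
    unfolding \<psi>_def using \<delta> by (intro continuous_intros) auto
  ultimately have 1: "continuous_on UNIV w"
    unfolding w_def by (intro continuous_on_scaleR)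
  have 2: "anorm \<tau> (w \<tau>) \<le> \<epsilon>" if \<tau>: "0 \<le> \<tau>" for \<tau>
  proof (cases "t \<le> \<tau> \<and> \<tau> \<le> t + 2")
    case True
    have "anorm \<tau> (w \<tau>) = \<psi> \<tau> * anorm \<tau> (U \<tau> t x)"
      using True \<psi>(1)[of \<tau>] by (simp add: w_def anorm_scale[OF \<tau>] max_absorb1)
    also have "\<dots> \<le> 1 * (exp (\<alpha> * (\<tau> - t)) * anorm t x)"
      using True by (intro mult_mono \<psi> anorm_evolution anorm_nonneg t0 \<tau>) auto
    also have "\<dots> \<le> exp (2 * \<alpha>) * anorm t x"
    proof -
      have "\<alpha> * (\<tau> - t) \<le> 2 * \<alpha>"
        using mult_left_mono[of "\<tau> - t" 2 \<alpha>] True \<alpha> by simp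
      then have "exp (\<alpha> * (\<tau> - t)) \<le> exp (2 * \<alpha>)" by simp
      then show ?thesis unfolding mult_1 by (rule mult_right_mono[OF _ a])
    qed
    also have "\<dots> \<le> \<epsilon> * C * anorm t x"
      using a by (intro mult_right_mono C)
    also have "\<dots> \<le> \<epsilon>"
      using small \<epsilon> by (simp add: mult.assoc mult_left_le)
    finally show ?thesis .
  next
    case False
    then show ?thesis
      using \<epsilon> \<psi>_before[of \<tau>] \<psi>_after[of \<tau>] \<tau> by (auto simp: w_def)
  qed
  have 3: "exp (- \<nu>) \<le> exp (\<nu> * (\<sigma> - (t + \<delta>))) * norm (U \<sigma> (t + \<delta>) (w (t + \<delta>)))"
  proof -
    have "U \<sigma> (t + \<delta>) (w (t + \<delta>)) = U \<sigma> t x"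
      using \<delta> t0 by (simp add: w_def \<psi>_def max_absorb1 cocycle)
    then have "exp (\<nu> * (\<sigma> - (t + \<delta>))) * norm (U \<sigma> (t + \<delta>) (w (t + \<delta>)))
        = exp (- (\<nu> * \<delta>)) * (exp (\<nu> * (\<sigma> - t)) * norm (U \<sigma> t x))"
      by (simp add: mult.assoc[symmetric] exp_add[symmetric]) (simp add: algebra_simps)
    also have "\<dots> = exp (- (\<nu> * \<delta>))" by (simp only: peak mult_1_right)
    also have "\<dots> \<ge> exp (- \<nu>)" using \<nu> \<delta> by simp
    finally show ?thesis .
  qed
  show ?thesis
  proof (rule that[of w t "t + 2"])
    show "\<exists>\<tau>\<ge>t. \<exists>\<sigma>\<ge>\<tau>. exp (- \<nu>) \<le> exp (\<nu> * (\<sigma> - \<tau>)) * norm (U \<sigma> \<tau> (w \<tau>))"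
      using 3 \<delta> by (intro exI[of _ "t + \<delta>"] conjI exI[of _ \<sigma>]) auto
  qed (use 1 2 t \<psi>_before \<psi>_after in \<open>auto simp: w_def\<close>)
qed

text \<open>
  Geometrically decreasing bounds give a uniformly convergent, hence continuous, sum; disjointness of
  the supports makes the sum equal to a single hump at each time, so that its adapted norm tends to
  zero and no hump is cancelled by another.
\<close>

lemma sum_of_humps:
  fixes w :: "nat \<Rightarrow> real \<Rightarrow> 'a" and p q :: "nat \<Rightarrow> real"
  assumes w_cont: "\<And>n. continuous_on UNIV (w n)"
    and before: "\<And>n \<tau>. \<tau> \<le> p n \<Longrightarrow> w n \<tau> = 0" and after: "\<And>n \<tau>. q n \<le> \<tau> \<Longrightarrow> w n \<tau> = 0"
    and p0: "0 \<le> p 0" and pq: "\<And>n. p n + 1 \<le> q n" and qp: "\<And>n. q n \<le> p (Suc n)"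
    and small: "\<And>n \<tau>. 0 \<le> \<tau> \<Longrightarrow> anorm \<tau> (w n \<tau>) \<le> (1 / 2) ^ n"
  shows "\<exists>u \<in> adm_space U \<alpha>. \<forall>n \<tau>. w n \<tau> \<noteq> 0 \<longrightarrow> u \<tau> = w n \<tau>"
proof -
  have mono_p: "mono p"
    unfolding mono_iff_le_Suc
  proof
    show "p n \<le> p (Suc n)" for n
      using pq[of n] qp[of n] by simp
  qed
  have disjoint: "q m \<le> p n" if "m < n" for m n
    using qp[of m] monoD[OF mono_p, of "Suc m" n] that by simp
  have p_nonneg: "0 \<le> p n" for n
    using p0 monoD[OF mono_p, of 0 n] by simp
  define u where "u \<tau> = (\<Sum>n. w n \<tau>)" for \<tau>
  have u_eq: "u \<tau> = w n \<tau>" if "w n \<tau> \<noteq> 0" for n \<tau>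
  proof -
    have \<tau>: "p n < \<tau>" "\<tau> < q n" using that before after by (meson not_le)+
    have "w m \<tau> = 0" if "m \<noteq> n" for m
    proof (cases "m < n")
      case True
      then show ?thesis using disjoint[OF True] \<tau> by (intro after) simp
    next
      case False
      then have "n < m" using that by simp
      then show ?thesis using disjoint[of n m] \<tau> by (intro before) simp
    qed
    then show ?thesis
      unfolding u_def by (subst suminf_finite[of "{n}"]) auto
  qed
  have u_cases: "u \<tau> = 0 \<or> (\<exists>n. w n \<tau> \<noteq> 0 \<and> u \<tau> = w n \<tau>)" for \<tau>
  proof (cases "\<exists>n. w n \<tau> \<noteq> 0")
    case True
    then show ?thesis using u_eq by blast
  next
    case False
    then show ?thesis by (simp add: u_def)
  qed
  have "uniform_limit {0..} (\<lambda>n \<tau>. \<Sum>i<n. w i \<tau>) u sequentially"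
    unfolding u_def
  proof (rule Weierstrass_m_test)
    fix n and \<tau> :: real assume "\<tau> \<in> {0..}"
    then show "norm (w n \<tau>) \<le> (1 / 2) ^ n"
      using small[of \<tau> n] norm_le_anorm[of \<tau> "w n \<tau>"] by simp
  qed (simp add: summable_geometric)
  then have "continuous_on {0..} u"
    by (rule uniform_limit_theorem[rotated])
      (auto intro!: always_eventually continuous_on_sum continuous_on_subset[OF w_cont])
  moreover have "u \<tau> = 0" if "\<tau> \<le> 0" for \<tau>
  proof -
    have "w n \<tau> = 0" for n
      by (rule before) (use p_nonneg[of n] that in simp)
    then show ?thesis by (simp add: u_def)
  qed
  moreover have "((\<lambda>\<tau>. anorm \<tau> (u \<tau>)) \<longlongrightarrow> 0) at_top"
  proof (rule order_tendstoI)
    fix a :: real assume a: "a < 0"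
    show "\<forall>\<^sub>F \<tau> in at_top. a < anorm \<tau> (u \<tau>)"
      using eventually_ge_at_top[of "0::real"]
      by eventually_elim (use anorm_nonneg a in \<open>force intro: less_le_trans\<close>)
  next
    fix a :: real assume a: "0 < a"
    obtain N where N: "(1 / 2 :: real) ^ N < a"
      using real_arch_pow_inv[OF a, of "1 / 2"] by auto
    show "\<forall>\<^sub>F \<tau> in at_top. anorm \<tau> (u \<tau>) < a"
      using eventually_ge_at_top[of "max 0 (q N)"]
    proof eventually_elim
      case (elim \<tau>)
      then have \<tau>: "0 \<le> \<tau>" "q N \<le> \<tau>" by auto
      show ?case
        using u_cases[of \<tau>]
      proof
        assume "u \<tau> = 0"
        then show ?thesis using a \<tau> by simp
      next
        assume "\<exists>n. w n \<tau> \<noteq> 0 \<and> u \<tau> = w n \<tau>"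
        then obtain n where n: "w n \<tau> \<noteq> 0" "u \<tau> = w n \<tau>" by blast
        have "N \<le> n"
        proof (rule ccontr)
          assume "\<not> N \<le> n"
          then have "q n \<le> \<tau>"
            using disjoint[of n N] pq[of N] \<tau> by simp
          then show False using after n by blast
        qed
        then have "(1 / 2 :: real) ^ n \<le> (1 / 2) ^ N"
          by (intro power_decreasing) auto
        then show ?thesis
          unfolding n(2) using small[OF \<tau>(1), of n] N by linarith
      qed
    qed
  qed
  ultimately have "u \<in> adm_space U \<alpha>"
    by (simp add: adm_space_iff)
  then show ?thesis using u_eq by blast
qed

text \<open>
  If the decay estimate failed for every constant, it would fail at arbitrarily late times, since on
  a bounded time interval \<open>N\<close> is bounded. The humps then add up to a function that belongs to the space
  for \<open>\<alpha>\<close> while its adapted norm for \<open>- \<nu>\<close> keeps returning above \<open>exp (- \<nu>)\<close>.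
\<close>

lemma stable_if_quasi_negative:
  assumes "quasi_negative U \<alpha>"
  shows adapted_stable
proof (cases "\<alpha> < 0")
  case True
  then show ?thesis by (rule stable_if_negative)
next
  case False
  obtain \<nu> N where \<nu>: "0 < \<nu>" and spaces: "adm_space U \<alpha> = adm_space U (- \<nu>)"
    and N: "continuous_on {0..} N" "\<forall>s\<ge>0. 0 < N s"
      "\<forall>s t. 0 \<le> s \<and> s \<le> t \<longrightarrow> norm (U t s) \<le> N s * exp (- \<nu> * (t - s))"
    using assms unfolding quasi_negative_def admissible_exponents_def by auto
  interpret neg: bounded_evolution U "- \<nu>" N
    by unfold_locales (use family N in auto)
  have "\<exists>C. \<forall>t\<ge>0. \<forall>\<sigma>\<ge>t. \<forall>x. norm (U \<sigma> t x) \<le> C * exp (- \<nu> * (\<sigma> - t)) * anorm t x"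
  proof (rule ccontr)
    assume contra: "\<not> ?thesis"
    have unstable: "\<exists>t\<ge>R. \<exists>\<sigma>\<ge>t. \<exists>x. C * exp (- \<nu> * (\<sigma> - t)) * anorm t x < norm (U \<sigma> t x)"
      if R: "0 \<le> R" for R C
    proof -
      obtain B where B: "0 < B" "\<And>t. 0 \<le> t \<Longrightarrow> t \<le> R \<Longrightarrow> N t \<le> B"
        using neg.bound_bounded[OF R] by blast
      obtain t \<sigma> x where t: "0 \<le> t" and \<sigma>: "t \<le> \<sigma>"
        and x: "max B C * exp (- \<nu> * (\<sigma> - t)) * anorm t x < norm (U \<sigma> t x)"
        using contra by (meson not_le)
      have c: "c * exp (- \<nu> * (\<sigma> - t)) * anorm t x < norm (U \<sigma> t x)" if "c \<le> max B C" for c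
      proof -
        have "c * exp (- \<nu> * (\<sigma> - t)) * anorm t x
            \<le> max B C * exp (- \<nu> * (\<sigma> - t)) * anorm t x"
          using that anorm_nonneg[OF t, of x] by (intro mult_right_mono) auto
        with x show ?thesis by linarith
      qed
      have "R \<le> t"
      proof (rule ccontr)
        assume "\<not> R \<le> t"
        then have "N t * exp (- \<nu> * (\<sigma> - t)) * norm x \<le> B * exp (- \<nu> * (\<sigma> - t)) * anorm t x"
          using B t by (intro mult_mono norm_le_anorm) auto
        then show False
          using c[OF max.cobounded1] neg.apply_bound[OF t \<sigma>, of x] by linarith
      qed
      then show ?thesis using c[of C] \<sigma> by auto
    qed
    \<comment> \<open>A hump is handled as a triple of the function and the end points of its support, as
      dependent choice produces one object per step.\<close>
    define H where "H \<epsilon> = (\<lambda>(w, p, q). continuous_on UNIV w \<and> 0 \<le> p \<and> p + 1 \<le> q \<and>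
      (\<forall>\<tau>\<le>p. w \<tau> = 0) \<and> (\<forall>\<tau>\<ge>q. w \<tau> = 0) \<and> (\<forall>\<tau>\<ge>0. anorm \<tau> (w \<tau>) \<le> \<epsilon>) \<and>
      (\<exists>\<tau>\<ge>p. \<exists>\<sigma>\<ge>\<tau>. exp (- \<nu>) \<le> exp (\<nu> * (\<sigma> - \<tau>)) * norm (U \<sigma> \<tau> (w \<tau>))))"
      for \<epsilon> :: real
    have H_ex: "\<exists>y. H \<epsilon> y \<and> R \<le> fst (snd y)" if R: "0 \<le> R" and \<epsilon>: "0 < \<epsilon>" for R \<epsilon>
    proof -
      have "0 \<le> \<alpha>" using False by simp
      from hump[OF this \<nu> \<epsilon> unstable[OF R] R] obtain w p q where
        w: "continuous_on UNIV w" "R \<le> p" "p + 1 \<le> q"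
          "\<And>\<tau>. \<tau> \<le> p \<Longrightarrow> w \<tau> = 0" "\<And>\<tau>. q \<le> \<tau> \<Longrightarrow> w \<tau> = 0"
          "\<And>\<tau>. 0 \<le> \<tau> \<Longrightarrow> anorm \<tau> (w \<tau>) \<le> \<epsilon>"
          "\<exists>\<tau>\<ge>p. \<exists>\<sigma>\<ge>\<tau>. exp (- \<nu>) \<le> exp (\<nu> * (\<sigma> - \<tau>)) * norm (U \<sigma> \<tau> (w \<tau>))"
        by blast
      have "H \<epsilon> (w, p, q)"
        unfolding H_def prod.case using w R by (intro conjI) auto
      then show ?thesis using w(2) by (intro exI[of _ "(w, p, q)"]) auto
    qed
    have "\<exists>f. \<forall>n. H ((1 / 2) ^ n) (f n) \<and> snd (snd (f n)) \<le> fst (snd (f (Suc n)))"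
    proof (rule dependent_nat_choice)
      show "\<exists>y. H ((1 / 2) ^ 0) y" using H_ex[of 0 1] by auto
      fix y n assume "H ((1 / 2) ^ n) y"
      then have "0 \<le> snd (snd y)" by (cases y) (auto simp: H_def)
      then show "\<exists>z. H ((1 / 2) ^ Suc n) z \<and> snd (snd y) \<le> fst (snd z)"
        by (rule H_ex) simp
    qed
    then obtain f where f: "\<And>n. H ((1 / 2) ^ n) (f n)"
      "\<And>n. snd (snd (f n)) \<le> fst (snd (f (Suc n)))" by blast
    define w p q where "w n = fst (f n)" and "p n = fst (snd (f n))" and "q n = snd (snd (f n))" for n
    have f_eq: "f n = (w n, p n, q n)" for n by (simp add: w_def p_def q_def)
    have Hn: "H ((1 / 2) ^ n) (w n, p n, q n)" for n using f(1)[of n] by (simp add: f_eq)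
    have qp: "q n \<le> p (Suc n)" for n using f(2)[of n] by (simp add: f_eq)
    have pq: "p n + 1 \<le> q n" for n using Hn[of n] by (simp add: H_def)
    have "\<exists>u \<in> adm_space U \<alpha>. \<forall>n \<tau>. w n \<tau> \<noteq> 0 \<longrightarrow> u \<tau> = w n \<tau>"
      by (rule sum_of_humps[of w p q]) (use Hn qp in \<open>auto simp: H_def\<close>)
    then obtain u where u: "u \<in> adm_space U (- \<nu>)" "\<And>n \<tau>. w n \<tau> \<noteq> 0 \<Longrightarrow> u \<tau> = w n \<tau>"
      using spaces by auto
    have "((\<lambda>\<tau>. neg.anorm \<tau> (u \<tau>)) \<longlongrightarrow> 0) at_top"
      using u(1) by (simp add: neg.adm_space_iff)
    then have "\<forall>\<^sub>F \<tau> in at_top. neg.anorm \<tau> (u \<tau>) < exp (- \<nu>)"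
      by (rule order_tendstoD) simp
    then obtain R where R: "\<And>\<tau>. R \<le> \<tau> \<Longrightarrow> neg.anorm \<tau> (u \<tau>) < exp (- \<nu>)"
      unfolding eventually_at_top_linorder by blast
    have p_ge: "real n \<le> p n" for n
    proof (induction n)
      case 0
      then show ?case using Hn[of 0] by (simp add: H_def)
    next
      case (Suc n)
      then show ?case using pq[of n] qp[of n] by simp
    qed
    obtain n :: nat where n: "R \<le> real n" using real_arch_simple by blast
    obtain \<tau> \<sigma> where \<tau>: "p n \<le> \<tau>" and \<sigma>: "\<tau> \<le> \<sigma>"
      and peak: "exp (- \<nu>) \<le> exp (\<nu> * (\<sigma> - \<tau>)) * norm (U \<sigma> \<tau> (w n \<tau>))"
      using Hn[of n] by (auto simp: H_def)
    have \<tau>0: "0 \<le> \<tau>" using p_ge[of n] \<tau> by linarith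
    have "w n \<tau> \<noteq> 0"
    proof
      assume "w n \<tau> = 0"
      then show False using peak by simp
    qed
    then have "u \<tau> = w n \<tau>" by (rule u(2))
    then have "norm (U \<sigma> \<tau> (w n \<tau>)) \<le> exp (- \<nu> * (\<sigma> - \<tau>)) * neg.anorm \<tau> (u \<tau>)"
      using neg.orbit_le[OF \<tau>0 \<sigma>, of "u \<tau>"] by simp
    then have "exp (\<nu> * (\<sigma> - \<tau>)) * norm (U \<sigma> \<tau> (w n \<tau>))
        \<le> exp (\<nu> * (\<sigma> - \<tau>)) * (exp (- \<nu> * (\<sigma> - \<tau>)) * neg.anorm \<tau> (u \<tau>))"
      by (rule mult_left_mono) simp
    also have "\<dots> = neg.anorm \<tau> (u \<tau>)"
      unfolding mult.assoc[symmetric] exp_add[symmetric] by simp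
    also have "\<dots> < exp (- \<nu>)" using R[of \<tau>] n p_ge[of n] \<tau> by simp
    finally show False using peak by simp
  qed
  then obtain C where C: "\<And>t \<sigma> x. 0 \<le> t \<Longrightarrow> t \<le> \<sigma> \<Longrightarrow>
      norm (U \<sigma> t x) \<le> C * exp (- \<nu> * (\<sigma> - t)) * anorm t x" by blast
  have "anorm t (U t s x) \<le> C * exp (- \<nu> * (t - s)) * anorm s x" if s: "0 \<le> s" and t: "s \<le> t" for s t x
  proof -
    have "anorm t (U t s x) \<le> neg.anorm t (U t s x)"
      by (rule adapted_norm_antimono[OF neg.bounded_evolution_axioms]) (use \<nu> False s t in auto)
    also have "\<dots> \<le> exp (- \<nu> * (t - s)) * neg.anorm s x"
      by (rule neg.anorm_evolution[OF s t])
    also have "\<dots> \<le> exp (- \<nu> * (t - s)) * (C * anorm s x)"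
    proof (rule mult_left_mono)
      show "neg.anorm s x \<le> C * anorm s x"
        by (rule neg.anorm_least) (use C[OF s] in \<open>simp add: mult_ac\<close>)
    qed simp
    finally show ?thesis by (simp add: mult_ac)
  qed
  then show ?thesis unfolding adapted_stable_def using \<nu> by blast
qed

section \<open>Exponential decay gives invertibility\<close>

definition duhamel :: "(real \<Rightarrow> 'a) \<Rightarrow> real \<Rightarrow> 'a" where
  "duhamel v t = integral {0..t} (\<lambda>\<tau>. U t \<tau> (v \<tau>))"

lemma duhamel_split:
  assumes v: "continuous_on {0..} v" and s: "0 \<le> s" "s \<le> t"
  shows "duhamel v t = U t s (duhamel v s) + integral {s..t} (\<lambda>\<tau>. U t \<tau> (v \<tau>))"
proof -
  have "integral {0..s} (\<lambda>\<tau>. U t \<tau> (v \<tau>)) = integral {0..s} (U t s \<circ> (\<lambda>\<tau>. U s \<tau> (v \<tau>)))"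
    by (rule integral_cong) (use s in \<open>simp add: cocycle\<close>)
  also have "\<dots> = U t s (duhamel v s)"
    unfolding duhamel_def
    by (rule integral_linear[OF orbit_integrand_integrable[OF v] blinfun.bounded_linear_right]) auto
  finally show ?thesis
    unfolding duhamel_def
    using Henstock_Kurzweil_Integration.integral_combine[OF s orbit_integrand_integrable[OF v order_refl order_refl]]
    by simp
qed

text \<open>
  Rescaling the integral to the fixed interval \<open>{0..1}\<close> avoids moving both the integrand and the
  domain of integration; after that, continuity in the parameter is a standard fact.
\<close>

lemma duhamel_continuous:
  assumes v: "continuous_on {0..} v"
  shows "continuous_on {0..} (duhamel v)"
proof -
  have rescaled: "duhamel v t = t *\<^sub>R integral (cbox 0 1) (\<lambda>r. U t (t * r) (v (t * r)))"
    if t: "t \<in> {0..}" for t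
  proof (cases "t = 0")
    case True
    then show ?thesis by (simp add: duhamel_def)
  next
    case False
    then have t: "0 < t" using t by simp
    let ?g = "\<lambda>r. U t (t * r) (v (t * r))"
    have "continuous_on {0..1} ?g"
      by (rule continuous_on_compose2[OF orbit_integrand_continuous[OF v, of t]])
        (use t in \<open>auto intro!: continuous_intros simp: mult_left_le\<close>)
    then have "(?g has_integral integral {0..1} ?g) {0..1}"
      by (intro integrable_integral integrable_continuous_real)
    from has_integral_affinity01[OF this, of "1 / t" 0]
    have "((\<lambda>\<tau>. U t \<tau> (v \<tau>)) has_integral t *\<^sub>R integral {0..1} ?g) ((\<lambda>r. r * t) ` {0..1})"
      using t by simp
    also have "(\<lambda>r. r * t) = (*) t"
      by (auto simp: mult.commute)
    also have "(*) t ` {0..1} = {0..t}"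
      using t by (simp add: image_mult_atLeastAtMost)
    finally show ?thesis
      by (simp add: duhamel_def integral_unique)
  qed
  have "continuous_on {0..} (\<lambda>t. t *\<^sub>R integral (cbox 0 1) (\<lambda>r. U t (t * r) (v (t * r))))"
  proof (intro continuous_intros integral_continuous_on_param)
    have "continuous_on ({0..} \<times> cbox 0 1) (\<lambda>p::real \<times> real. (fst p, fst p * snd p))"
      by (intro continuous_intros)
    from continuous_on_compose2[OF jointly_continuous[OF v] this]
    show "continuous_on ({0..} \<times> cbox 0 1) (\<lambda>(t, r). U t (t * r) (v (t * r)))"
      by (auto simp: case_prod_unfold image_subset_iff mult_left_le)
  qed
  then show ?thesis
    by (rule continuous_on_eq) (rule rescaled[symmetric])
qed

text \<open>
  Strong continuity of the semigroup at zero. Late in time both terms are small separately, as \<open>v\<close>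
  vanishes at infinity in the adapted norms; on a compact time interval the adapted norms are
  dominated by a multiple of the original norm, and joint continuity is uniform.
  For \<open>\<tau> = 0\<close> the estimate also says that \<open>v\<close> is small near time zero.
\<close>

lemma strong_continuity:
  assumes v: "v \<in> adm_space U \<alpha>" and \<epsilon>: "0 < \<epsilon>"
  obtains \<delta> where "0 < \<delta>"
    "\<And>s \<tau>. \<lbrakk>0 \<le> \<tau>; \<tau> \<le> s; s - \<delta> \<le> \<tau>\<rbrakk> \<Longrightarrow> anorm s (U s \<tau> (v \<tau>) - v s) \<le> \<epsilon>"
proof -
  have v_cont: "continuous_on {0..} v" and v_lim: "((\<lambda>t. anorm t (v t)) \<longlongrightarrow> 0) at_top"
    using v by (auto simp: adm_space_iff)
  define \<epsilon>' where "\<epsilon>' = \<epsilon> / (exp \<bar>\<alpha>\<bar> + 1)"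
  have pos: "0 < exp \<bar>\<alpha>\<bar> + 1" by (simp add: add_pos_pos)
  then have "(exp \<bar>\<alpha>\<bar> + 1) * \<epsilon>' = \<epsilon>" by (simp add: \<epsilon>'_def)
  then have \<epsilon>': "0 < \<epsilon>'" "exp \<bar>\<alpha>\<bar> * \<epsilon>' + \<epsilon>' = \<epsilon>"
    using \<epsilon> pos by (simp add: \<epsilon>'_def, simp only: distrib_right mult_1)
  have "\<forall>\<^sub>F t in at_top. anorm t (v t) < \<epsilon>'"
    using v_lim \<epsilon>'(1) by (rule order_tendstoD)
  then obtain R0 where R0: "\<And>t. R0 \<le> t \<Longrightarrow> anorm t (v t) < \<epsilon>'"
    unfolding eventually_at_top_linorder by blast
  define R where "R = max R0 0 + 1"
  have R: "0 \<le> R" "R0 \<le> R - 1" "0 \<le> R - 1" by (auto simp: R_def)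
  obtain B where B: "0 < B" "\<And>t. 0 \<le> t \<Longrightarrow> t \<le> R \<Longrightarrow> M t \<le> B"
    using bound_bounded[OF R(1)] by blast
  let ?K = "({0..R} \<times> {0..R}) \<inter> {p. snd p \<le> fst p}"
  have "compact ?K"
    by (intro compact_Int_closed compact_Times compact_Icc closed_Collect_le continuous_intros)
  moreover have "continuous_on ?K (\<lambda>p. U (fst p) (snd p) (v (snd p)))"
    by (rule continuous_on_subset[OF jointly_continuous[OF v_cont]]) auto
  ultimately have "uniformly_continuous_on ?K (\<lambda>p. U (fst p) (snd p) (v (snd p)))"
    by (rule compact_uniformly_continuous[rotated])
  moreover have "0 < \<epsilon> / B" using \<epsilon> B by simp
  ultimately obtain \<delta>1 where \<delta>1: "0 < \<delta>1" "\<And>p q. \<lbrakk>p \<in> ?K; q \<in> ?K; dist q p < \<delta>1\<rbrakk> \<Longrightarrow>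
      dist (U (fst q) (snd q) (v (snd q))) (U (fst p) (snd p) (v (snd p))) < \<epsilon> / B"
    unfolding uniformly_continuous_on_def by blast
  define \<delta> where "\<delta> = min 1 (\<delta>1 / 2)"
  have \<delta>: "0 < \<delta>" "\<delta> \<le> 1" "\<delta> < \<delta>1" using \<delta>1(1) by (auto simp: \<delta>_def min_def)
  have "anorm s (U s \<tau> (v \<tau>) - v s) \<le> \<epsilon>" if \<tau>: "0 \<le> \<tau>" "\<tau> \<le> s" "s - \<delta> \<le> \<tau>" for s \<tau>
  proof (cases "s \<le> R")
    case True
    have s: "0 \<le> s" using \<tau> by simp
    have "dist (s, \<tau>) (s, s) < \<delta>1"
      using \<tau> \<delta> by (simp add: dist_Pair_Pair dist_real_def)
    with \<delta>1(2)[of "(s, s)" "(s, \<tau>)"] \<tau> s True have "norm (U s \<tau> (v \<tau>) - v s) < \<epsilon> / B"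
      by (simp add: dist_norm)
    then have "M s * norm (U s \<tau> (v \<tau>) - v s) \<le> B * (\<epsilon> / B)"
      using B s True by (intro mult_mono) auto
    then show ?thesis
      using anorm_le_bound[OF s, of "U s \<tau> (v \<tau>) - v s"] B by simp
  next
    case False
    have s: "0 \<le> s" using \<tau> by simp
    have "\<alpha> * (s - \<tau>) \<le> \<bar>\<alpha>\<bar> * 1"
      using \<tau> \<delta> by (intro mult_mono) auto
    moreover have "anorm \<tau> (v \<tau>) \<le> \<epsilon>'"
      using R0[of \<tau>] \<tau> \<delta> R False by simp
    ultimately have "exp (\<alpha> * (s - \<tau>)) * anorm \<tau> (v \<tau>) \<le> exp \<bar>\<alpha>\<bar> * \<epsilon>'"
      using anorm_nonneg[OF \<tau>(1)] by (intro mult_mono) auto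
    moreover have "anorm s (v s) \<le> \<epsilon>'"
      using R0[of s] R False by simp
    ultimately show ?thesis
      using anorm_diff[OF s, of "U s \<tau> (v \<tau>)" "v s"] anorm_evolution[OF \<tau>(1,2), of "v \<tau>"] \<epsilon>'(2)
      by linarith
  qed
  then show ?thesis using that \<delta>(1) by blast
qed

text \<open>
  The sign makes this the preimage of \<open>v\<close> under the generator rather than under its negative; the
  value zero at negative times is the convention for functions on the half-line.
\<close>

definition mild_solution :: "(real \<Rightarrow> 'a) \<Rightarrow> real \<Rightarrow> 'a" where
  "mild_solution v t = (if t < 0 then 0 else - duhamel v t)"

text \<open>
  For \<open>h < s\<close> the semigroup transports the part of the integral up to \<open>s - h\<close>, and only the last piece
  is left; for \<open>s \<le> h\<close> it produces zero, and the whole integral is left.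
\<close>

lemma mild_solution_step:
  assumes v: "v \<in> adm_space U \<alpha>" and h: "0 < h" and s: "0 \<le> s"
  shows "evol_semigroup U h (mild_solution v) s - mild_solution v s
    = integral {max 0 (s - h)..s} (\<lambda>\<tau>. U s \<tau> (v \<tau>))"
proof (cases "h < s")
  case True
  have "continuous_on {0..} v" using v by (simp add: adm_space_iff)
  from duhamel_split[OF this, of "s - h" s] show ?thesis
    using True h by (simp add: evol_semigroup_def mild_solution_def max_absorb2 blinfun.minus_right)
next
  case False
  then show ?thesis
    using s by (simp add: evol_semigroup_def mild_solution_def duhamel_def max_absorb1)
qed

text \<open>
  The difference quotient minus \<open>v s\<close> is the mean of \<open>U s \<tau> (v \<tau>) - v s\<close> over the last \<open>h\<close> units of time,
  which strong continuity makes uniformly small. When \<open>s < h\<close> the missing part of the interval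
  contributes a multiple of \<open>v s\<close>, small because \<open>v\<close> vanishes at time zero.
\<close>

lemma gen_value_mild_solution:
  assumes v: "v \<in> adm_space U \<alpha>"
  shows "is_gen_value U \<alpha> (mild_solution v) v"
  unfolding is_gen_value_def
proof (intro conjI v)
  let ?q = "\<lambda>h s. (evol_semigroup U h (mild_solution v) s - mild_solution v s) /\<^sub>R h - v s"
  have v_cont: "continuous_on {0..} v" and v0: "v 0 = 0"
    using v by (auto simp: adm_space_iff)
  have main: "\<exists>\<delta>>0. \<forall>h. 0 < h \<longrightarrow> h < \<delta> \<longrightarrow> \<bar>adm_norm U \<alpha> (?q h)\<bar> \<le> \<epsilon>" if \<epsilon>: "0 < \<epsilon>" for \<epsilon>
  proof -
    obtain \<delta> where \<delta>: "0 < \<delta>"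
      "\<And>s \<tau>. \<lbrakk>0 \<le> \<tau>; \<tau> \<le> s; s - \<delta> \<le> \<tau>\<rbrakk> \<Longrightarrow> anorm s (U s \<tau> (v \<tau>) - v s) \<le> \<epsilon>"
      using strong_continuity[OF v \<epsilon>] by blast
    have "anorm s (?q h s) \<le> \<epsilon>" if h: "0 < h" "h < \<delta>" and s: "0 \<le> s" for h s
    proof -
      let ?a = "max 0 (s - h)"
      let ?f = "\<lambda>\<tau>. U s \<tau> (v \<tau>)"
      have a: "0 \<le> ?a" "?a \<le> s" "s - ?a \<le> h" using s h by auto
      have f: "?f integrable_on {?a..s}"
        by (rule orbit_integrand_integrable[OF v_cont]) (use a in auto)
      have "integral {?a..s} (\<lambda>\<tau>. ?f \<tau> - v s) = integral {?a..s} ?f - (s - ?a) *\<^sub>R v s"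
        using a by (simp add: Henstock_Kurzweil_Integration.integral_diff[OF f integrable_const_ivl])
      then have split: "h *\<^sub>R ?q h s = integral {?a..s} (\<lambda>\<tau>. ?f \<tau> - v s) - (h - (s - ?a)) *\<^sub>R v s"
        using h by (simp add: mild_solution_step[OF v h(1) s] scaleR_diff_right scaleR_diff_left)
      have 1: "anorm s (integral {?a..s} (\<lambda>\<tau>. ?f \<tau> - v s)) \<le> integral {?a..s} (\<lambda>\<tau>. \<epsilon>)"
        by (rule anorm_integral_le[OF s integrable_diff[OF f integrable_const_ivl] integrable_const_ivl])
          (use \<delta>(2) a h in auto)
      have 2: "anorm s ((h - (s - ?a)) *\<^sub>R v s) \<le> (h - (s - ?a)) * \<epsilon>"
      proof (cases "h \<le> s")
        case True
        then show ?thesis using s by simp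
      next
        case False
        then have "anorm s (v s) \<le> \<epsilon>"
          using \<delta>(2)[of 0 s] h s v0 by (simp add: anorm_minus)
        then have "(h - (s - ?a)) * anorm s (v s) \<le> (h - (s - ?a)) * \<epsilon>"
          using a by (intro mult_left_mono) auto
        then show ?thesis using a by (simp add: anorm_scale[OF s])
      qed
      have "anorm s (h *\<^sub>R ?q h s) \<le> integral {?a..s} (\<lambda>\<tau>. \<epsilon>) + (h - (s - ?a)) * \<epsilon>"
        unfolding split
        using 1 2 anorm_diff[OF s, of "integral {?a..s} (\<lambda>\<tau>. ?f \<tau> - v s)" "(h - (s - ?a)) *\<^sub>R v s"]
        by linarith
      also have "\<dots> = h * \<epsilon>" using a by (simp add: algebra_simps)
      finally show ?thesis using h by (simp add: anorm_scale[OF s])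
    qed
    then have "\<bar>adm_norm U \<alpha> (?q h)\<bar> \<le> \<epsilon>" if "0 < h" "h < \<delta>" for h
      using adm_norm_least[of "?q h" \<epsilon>] that by auto
    then show ?thesis using \<delta>(1) by blast
  qed
  show "((\<lambda>h. adm_norm U \<alpha> (?q h)) \<longlongrightarrow> 0) (at_right 0)"
  proof (rule tendstoI)
    fix e :: real assume "0 < e"
    then have "0 < e / 2" by simp
    from main[OF this] obtain \<delta> where "0 < \<delta>"
      and \<delta>: "\<And>h. 0 < h \<Longrightarrow> h < \<delta> \<Longrightarrow> \<bar>adm_norm U \<alpha> (?q h)\<bar> \<le> e / 2" by blast
    show "\<forall>\<^sub>F h in at_right 0. dist (adm_norm U \<alpha> (?q h)) 0 < e"
      unfolding eventually_at_right_field
    proof (intro exI conjI allI impI)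
      show "0 < \<delta>" by fact
      show "dist (adm_norm U \<alpha> (?q h)) 0 < e" if "0 < h" "h < \<delta>" for h
        using \<delta>[OF that] \<open>0 < e\<close> by simp
    qed
  qed
qed

lemma stable_integral_bound:
  assumes \<nu>: "0 < \<nu>" and C: "0 \<le> C"
    and stable: "\<And>s t x. 0 \<le> s \<Longrightarrow> s \<le> t \<Longrightarrow>
      anorm t (U t s x) \<le> C * exp (- \<nu> * (t - s)) * anorm s x"
    and v: "continuous_on {0..} v" and a: "0 \<le> a" "a \<le> t"
    and c: "\<And>\<tau>. a \<le> \<tau> \<Longrightarrow> \<tau> \<le> t \<Longrightarrow> anorm \<tau> (v \<tau>) \<le> c"
  shows "anorm t (integral {a..t} (\<lambda>\<tau>. U t \<tau> (v \<tau>))) \<le> C * c / \<nu>"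
proof -
  have c0: "0 \<le> c" using c[of a] a anorm_nonneg[of a "v a"] by simp
  have int: "((\<lambda>\<tau>. C * c * exp (\<nu> * (\<tau> - t))) has_integral
      C * c * ((exp (\<nu> * (t - t)) - exp (\<nu> * (a - t))) / \<nu>)) {a..t}"
    by (rule has_integral_mult_right[OF integral_exp_shift[OF \<nu> a(2)]])
  have "anorm t (integral {a..t} (\<lambda>\<tau>. U t \<tau> (v \<tau>)))
      \<le> integral {a..t} (\<lambda>\<tau>. C * c * exp (\<nu> * (\<tau> - t)))"
  proof (rule anorm_integral_le)
    fix \<tau> assume \<tau>: "\<tau> \<in> {a..t}"
    have "anorm t (U t \<tau> (v \<tau>)) \<le> C * exp (- \<nu> * (t - \<tau>)) * anorm \<tau> (v \<tau>)"
      using \<tau> a by (intro stable) auto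
    also have "\<dots> \<le> C * exp (- \<nu> * (t - \<tau>)) * c"
      using C c \<tau> by (intro mult_left_mono) auto
    also have "\<dots> = C * c * exp (\<nu> * (\<tau> - t))"
      by (simp add: algebra_simps)
    finally show "anorm t (U t \<tau> (v \<tau>)) \<le> C * c * exp (\<nu> * (\<tau> - t))" .
  qed (use a int orbit_integrand_integrable[OF v a(1)] in auto)
  also have "\<dots> = C * c * ((exp (\<nu> * (t - t)) - exp (\<nu> * (a - t))) / \<nu>)"
    by (rule integral_unique[OF int])
  also have "\<dots> \<le> C * c * (1 / \<nu>)"
    using C c0 \<nu> by (intro mult_left_mono divide_right_mono) auto
  finally show ?thesis by simp
qed

text \<open>
  The integral estimate with \<open>a = 0\<close> bounds the inverse by \<open>C / \<nu>\<close>. To see that the solution vanishes at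
  infinity, split the integral at a time \<open>R\<close> after which \<open>v\<close> is small: the later part is small by the
  same estimate, and the earlier part is the orbit of a fixed vector, which decays.
\<close>

lemma invertible_if_stable:
  assumes adapted_stable
  shows "invertible_operator (adm_space U \<alpha>) (adm_norm U \<alpha>) (gen_domain U \<alpha>) (generator U \<alpha>)"
proof -
  obtain \<nu> C0 where \<nu>: "0 < \<nu>" and C0: "\<And>s t x. 0 \<le> s \<Longrightarrow> s \<le> t \<Longrightarrow>
      anorm t (U t s x) \<le> C0 * exp (- \<nu> * (t - s)) * anorm s x"
    using assms unfolding adapted_stable_def by blast
  define C where "C = max C0 1"
  have C: "0 < C" by (simp add: C_def)
  have stable: "anorm t (U t s x) \<le> C * exp (- \<nu> * (t - s)) * anorm s x"
    if "0 \<le> s" "s \<le> t" for s t x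
  proof -
    have "C0 * exp (- \<nu> * (t - s)) * anorm s x \<le> C * exp (- \<nu> * (t - s)) * anorm s x"
      using anorm_nonneg[OF that(1), of x] by (intro mult_right_mono) (auto simp: C_def)
    then show ?thesis using C0[OF that, of x] by linarith
  qed
  have bound_integral: "anorm t (integral {a..t} (\<lambda>\<tau>. U t \<tau> (v \<tau>))) \<le> C * c / \<nu>"
    if "continuous_on {0..} v" "0 \<le> a" "a \<le> t"
      and "\<And>\<tau>. a \<le> \<tau> \<Longrightarrow> \<tau> \<le> t \<Longrightarrow> anorm \<tau> (v \<tau>) \<le> c" for v a t c
    by (rule stable_integral_bound[OF \<nu> less_imp_le[OF C] _ that(1-3)])
      (use stable that(4) in blast)+
  have mild_le: "adm_norm U \<alpha> (mild_solution v) \<le> C / \<nu> * adm_norm U \<alpha> v"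
    if v: "v \<in> adm_space U \<alpha>" for v
  proof (rule adm_norm_least)
    fix t :: real assume t: "0 \<le> t"
    have "continuous_on {0..} v" using v by (simp add: adm_space_iff)
    from bound_integral[OF this order_refl t, of "adm_norm U \<alpha> v"]
    show "anorm t (mild_solution v t) \<le> C / \<nu> * adm_norm U \<alpha> v"
      using t anorm_le_adm_norm[OF v] by (simp add: mild_solution_def duhamel_def anorm_minus)
  qed
  have mild: "mild_solution v \<in> adm_space U \<alpha>" if v: "v \<in> adm_space U \<alpha>" for v
  proof -
    have v_cont: "continuous_on {0..} v" and v_lim: "((\<lambda>t. anorm t (v t)) \<longlongrightarrow> 0) at_top"
      using v by (auto simp: adm_space_iff)
    have "continuous_on {0..} (\<lambda>t. - duhamel v t)"
      by (intro continuous_intros duhamel_continuous v_cont)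
    then have "continuous_on {0..} (mild_solution v)"
      by (rule continuous_on_eq) (simp add: mild_solution_def)
    moreover have "((\<lambda>t. anorm t (mild_solution v t)) \<longlongrightarrow> 0) at_top"
    proof (rule order_tendstoI)
      fix e :: real assume e: "e < 0"
      show "\<forall>\<^sub>F t in at_top. e < anorm t (mild_solution v t)"
        using eventually_ge_at_top[of "0::real"]
        by eventually_elim (use anorm_nonneg e in \<open>force intro: less_le_trans\<close>)
    next
      fix e :: real assume e: "0 < e"
      define c where "c = e / 2 * \<nu> / C"
      have c: "0 < c" "C * c / \<nu> = e / 2" using e \<nu> C by (auto simp: c_def)
      have "\<forall>\<^sub>F t in at_top. anorm t (v t) < c"
        using v_lim c(1) by (rule order_tendstoD)
      then obtain R0 where R0: "\<And>t. R0 \<le> t \<Longrightarrow> anorm t (v t) < c"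
        unfolding eventually_at_top_linorder by blast
      define R where "R = max R0 0"
      have R: "0 \<le> R" "R0 \<le> R" by (auto simp: R_def)
      have "filterlim (\<lambda>t. t - R) at_top at_top"
        using filterlim_tendsto_add_at_top[OF tendsto_const[of "- R"] filterlim_ident] by simp
      then have "filterlim (\<lambda>t. - \<nu> * (t - R)) at_bot at_top"
        using \<nu> by (intro filterlim_tendsto_neg_mult_at_bot[OF tendsto_const]) auto
      then have "((\<lambda>t. exp (- \<nu> * (t - R))) \<longlongrightarrow> 0) at_top"
        by (rule filterlim_compose[OF exp_at_bot])
      then have "((\<lambda>t. C * exp (- \<nu> * (t - R)) * anorm R (duhamel v R)) \<longlongrightarrow> 0) at_top"
        by (intro tendsto_mult_left_zero tendsto_mult_right_zero)
      then have "\<forall>\<^sub>F t in at_top. C * exp (- \<nu> * (t - R)) * anorm R (duhamel v R) < e / 2"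
        by (rule order_tendstoD) (use e in simp)
      then show "\<forall>\<^sub>F t in at_top. anorm t (mild_solution v t) < e"
        using eventually_ge_at_top[of R]
      proof eventually_elim
        case (elim t)
        then have t: "0 \<le> t" "R \<le> t" using R by auto
        have "anorm t (integral {R..t} (\<lambda>\<tau>. U t \<tau> (v \<tau>))) \<le> C * c / \<nu>"
          by (rule bound_integral[OF v_cont R(1) t(2)]) (use R0 R in \<open>auto intro: less_imp_le\<close>)
        then have "anorm t (duhamel v t) < e"
          unfolding duhamel_split[OF v_cont R(1) t(2)]
          using anorm_triangle[OF t(1)] stable[OF R(1) t(2)] elim(1) c(2)
          by (smt (verit) field_sum_of_halves)
        then show ?case using t by (simp add: mild_solution_def anorm_minus)
      qed
    qed
    moreover have "mild_solution v 0 = 0" by (simp add: mild_solution_def duhamel_def)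
    ultimately show ?thesis by (simp add: adm_space_iff mild_solution_def)
  qed
  have gen_mild: "generator U \<alpha> (mild_solution v) = v" "mild_solution v \<in> gen_domain U \<alpha>"
    if "v \<in> adm_space U \<alpha>" for v
    using generator_eq[OF mild gen_value_mild_solution] gen_value_mild_solution mild that
    by (auto simp: gen_domain_def)
  have mild_gen: "mild_solution (generator U \<alpha> u) = u" "generator U \<alpha> u \<in> adm_space U \<alpha>"
    if "u \<in> gen_domain U \<alpha>" for u
  proof -
    obtain v where u: "u \<in> adm_space U \<alpha>" and v: "is_gen_value U \<alpha> u v"
      using \<open>u \<in> gen_domain U \<alpha>\<close> by (auto simp: gen_domain_def)
    have [simp]: "generator U \<alpha> u = v" by (rule generator_eq[OF u v])
    show "generator U \<alpha> u \<in> adm_space U \<alpha>" using v by (simp add: is_gen_value_def)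
    show "mild_solution (generator U \<alpha> u) = u"
    proof
      fix t
      show "mild_solution (generator U \<alpha> u) t = u t"
        using u gen_value_integral[OF u v, of t]
        by (cases "t < 0") (auto simp: mild_solution_def duhamel_def adm_space_iff)
    qed
  qed
  have bij: "bij_betw (generator U \<alpha>) (gen_domain U \<alpha>) (adm_space U \<alpha>)"
    by (rule bij_betw_byWitness[where f' = mild_solution]) (use gen_mild mild_gen in auto)
  have "inv_into (gen_domain U \<alpha>) (generator U \<alpha>) v = mild_solution v" if "v \<in> adm_space U \<alpha>" for v
    using bij gen_mild[OF that] by (intro inv_into_f_eq) (auto simp: bij_betw_def)
  then show ?thesis
    unfolding invertible_operator_def using bij mild_le by (intro conjI exI[of _ "C / \<nu>"]) auto
qed

end

theorem theorem3p4:
  fixes U :: "real \<Rightarrow> real \<Rightarrow> 'a::banach \<Rightarrow>\<^sub>L 'a" and \<alpha> :: real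
  assumes "evolution_family U"
    and "nonuniform_exp_bounded U"
    and "\<alpha> \<in> admissible_exponents U"
  shows "invertible_operator (adm_space U \<alpha>) (adm_norm U \<alpha>) (gen_domain U \<alpha>) (generator U \<alpha>)
           \<longleftrightarrow> quasi_negative U \<alpha>"
proof -
  obtain M where M: "continuous_on {0..} M" "\<forall>s\<ge>0. 0 < M s"
    "\<forall>s t. 0 \<le> s \<and> s \<le> t \<longrightarrow> norm (U t s) \<le> M s * exp (\<alpha> * (t - s))"
    using assms(3) unfolding admissible_exponents_def by blast
  interpret bounded_evolution U \<alpha> M
    by unfold_locales (use assms(1) M in auto)
  show ?thesis
    using stable_if_invertible quasi_negative_if_stable stable_if_quasi_negative invertible_if_stable
    by blast
qed

end
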